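(* Let $N\ge2$, $0\le k\le N$, and let $\mathcal{K}$ be a partial categorical $\dot{\mathcal{U}}_{0,N}(L\mathfrak{sl}_2)$ action. For $\boldsymbol{\mu}=(\mu_1,\dots,\mu_{N-k})\in P(k,N-k)$ put $$\mathsf{E}_{-\boldsymbol{\mu}}\mathbf{1}_{(N,0)}:=\mathsf{E}_{-\mu_1}\cdots\mathsf{E}_{-\mu_{N-k}}\mathbf{1}_{(N,0)}\in\mathrm{Hom}(\mathcal{K}(N,0),\mathcal{K}(k,N-k)).$$ Then: (1) $\mathrm{Hom}(\mathsf{E}_{-\boldsymbol{\mu}}\mathbf{1}_{(N,0)},\mathsf{E}_{-\boldsymbol{\mu}}\mathbf{1}_{(N,0)})\cong\mathrm{Hom}(\mathbf{1}_{(N,0)},\mathbf{1}_{(N,0)})$ for all $\boldsymbol{\mu}\in P(k,N-k)$; (2) $\mathrm{Hom}(\mathsf{E}_{-\boldsymbol{\mu}}\mathbf{1}_{(N,0)},\mathsf{E}_{-\boldsymbol{\mu}'}\mathbf{1}_{(N,0)})\cong0$ for all $\boldsymbol{\mu},\boldsymbol{\mu}'\in P(k,N-k)$ with $\boldsymbol{\mu}<_l\boldsymbol{\mu}'$.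
   Context: $P(a,b)$ is the set of integer sequences $(\mu_1,\dots,\mu_b)$ with $a\ge\mu_1\ge\dots\ge\mu_b\ge0$. Lexicographic order: $\boldsymbol{\mu}<_l\boldsymbol{\mu}'$ iff at the first index $j$ where they differ, $\mu_j<\mu_j'$. **Partial categorical $\dot{\mathcal{U}}_{0,N}(L\mathfrak{sl}_2)$ action.** Weights: $C(2,N)=\{(k_1,k_2)\in\mathbb{Z}_{\ge0}^2:k_1+k_2=N\}$, $\alpha=(-1,1)$. The action consists of a 2-category $\mathcal{K}$ which is triangulated (Hom-categories are triangulated and composition is exact), $\mathbb{C}$-linear and idempotent complete, with objects triangulated categories $\mathcal{K}(k_1,k_2)$, $(k_1,k_2)\in C(2,N)$, and triangulated categories $\mathrm{Hom}(\mathcal{K}(\underline{k}),\mathcal{K}(\underline{l}))$ of 1-morphisms (called functors); $\mathrm{Hom}(-,-)$ between 1-morphisms is the space of 2-morphisms. There are 1-morphisms: identities $\mathbf{1}_{\underline{k}}$; $\mathsf{E}_r\mathbf{1}_{\underline{k}}=\mathbf{1}_{\underline{k}+\alpha}\mathsf{E}_r:\mathcal{K}(\underline{k})\to\mathcal{K}(\underline{k}+\alpha)$, $-k_1-1\le r\le0$; $\mathsf{F}_s\mathbf{1}_{\underline{k}}=\mathbf{1}_{\underline{k}-\alpha}\mathsf{F}_s:\mathcal{K}(\underline{k})\to\mathcal{K}(\underline{k}-\alpha)$, $0\le s\le k_2+1$; $(\mathsf{\Psi}^\pm)^{\pm1}\mathbf{1}_{\underline{k}}$ (endo-1-morphisms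 of $\mathcal{K}(\underline{k})$, mutually inverse); and $\mathsf{H}_{\pm1}\mathbf{1}_{\underline{k}}$, on which no condition is imposed. Weights outside $C(2,N)$ are treated as zero: any 1-morphism through such a weight is $0$. Conditions, for all $r,s$ for which they make sense (isomorphisms abstract): 1. The space of maps between any two 1-morphisms is finite-dimensional. 2. $\mathbf{1}_{\underline{k}+r\alpha}=0$ for $r\gg0$ or $r\ll0$. 3. (A condition involving two distinct simple roots; vacuous for $\mathfrak{sl}_2$.) 4. (a) $(\mathsf{E}_r\mathbf{1}_{\underline{k}})^R\cong\mathbf{1}_{\underline{k}}(\mathsf{\Psi}^+)^{r+1}\mathsf{F}_{k_2+2}(\mathsf{\Psi}^+)^{-r-2}[-r-1]$; (b) $(\mathsf{F}_s\mathbf{1}_{\underline{k}})^R\cong\mathbf{1}_{\underline{k}}(\mathsf{\Psi}^-)^{-s+1}\mathsf{E}_{-k_1-2}(\mathsf{\Psi}^-)^{s-2}[s-1]$ (right adjoints). 5. (a) $\mathsf{\Psi}^\pm\mathsf{E}_r\mathbf{1}_{\underline{k}}\cong\mathsf{E}_{r+1}\mathsf{\Psi}^\pm\mathbf{1}_{\underline{k}}[\mp1]$; (b) $\mathsf{\Psi}^\pm\mathsf{F}_s\mathbf{1}_{\underline{k}}\cong\mathsf{F}_{s-1}\mathsf{\Psi}^\pm\mathbf{1}_{\underline{k}}[\pm1]$. 6. (a) if $r+s=k_2$ there is an exact triangle $\mathsf{F}_s\mathsf{E}_r\mathbf{1}_{\underline{k}}\to\mathsf{E}_r\mathsf{F}_s\mathbf{1}_{\underline{k}}\to\mathsf{\Psi}^+\mathbf{1}_{\underline{k}}$;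 (b) if $r+s=-k_1$ there is an exact triangle $\mathsf{E}_r\mathsf{F}_s\mathbf{1}_{\underline{k}}\to\mathsf{F}_s\mathsf{E}_r\mathbf{1}_{\underline{k}}\to\mathsf{\Psi}^-\mathbf{1}_{\underline{k}}$; (c) if $-k_1+1\le r+s\le k_2-1$ then $\mathsf{F}_s\mathsf{E}_r\mathbf{1}_{\underline{k}}\cong\mathsf{E}_r\mathsf{F}_s\mathbf{1}_{\underline{k}}$. *)

theory Defs
  imports Complex_Main "HOL-Algebra.Algebraic_Closure_Type"
begin

section \<open>Linear maps between modules over a commutative ring type\<close>

definition linear_map :: "('r::comm_ring_1, 'm) module \<Rightarrow> ('r, 'n) module \<Rightarrow> ('m \<Rightarrow> 'n) \<Rightarrow> bool" where
  "linear_map V W \<phi> \<longleftrightarrow>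
     \<phi> \<in> carrier V \<rightarrow> carrier W \<and>
     (\<forall>u\<in>carrier V. \<forall>v\<in>carrier V. \<phi> (u \<oplus>\<^bsub>V\<^esub> v) = \<phi> u \<oplus>\<^bsub>W\<^esub> \<phi> v) \<and>
     (\<forall>c. \<forall>v\<in>carrier V. \<phi> (c \<odot>\<^bsub>V\<^esub> v) = c \<odot>\<^bsub>W\<^esub> \<phi> v)"

definition linearly_isomorphic :: "('r::comm_ring_1, 'm) module \<Rightarrow> ('r, 'n) module \<Rightarrow> bool" where
  "linearly_isomorphic V W \<longleftrightarrow> (\<exists>\<phi>. linear_map V W \<phi> \<and> bij_betw \<phi> (carrier V) (carrier W))"

definition finite_dimensional :: "('r::field, 'm) module \<Rightarrow> bool" where
  "finite_dimensional V \<longleftrightarrow>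
     (\<exists>B. finite B \<and> B \<subseteq> carrier V \<and>
        (\<forall>v\<in>carrier V. \<exists>c. v = (\<Oplus>\<^bsub>V\<^esub>b\<in>B. c b \<odot>\<^bsub>V\<^esub> b)))"


section \<open>Linear, additive and triangulated categories\<close>

text \<open>
  The scalars of a category are the elements of the type \<open>'r\<close>; \<open>'r = int\<close> gives preadditive
  categories. Composition \<open>g \<cdot> f\<close> is in the usual order (first \<open>f\<close>) and does not carry the objects
  as arguments; this loses no generality, since morphisms can be tagged with source and target.
\<close>

record ('r, 'o, 'm) category =
  Ob :: "'o set"
  Mor :: "'o \<Rightarrow> 'o \<Rightarrow> ('r, 'm) module"
  cmp :: "'m \<Rightarrow> 'm \<Rightarrow> 'm"  (infixl \<open>\<cdot>\<index>\<close> 70)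
  ident :: "'o \<Rightarrow> 'm"

abbreviation mor :: "('r, 'o, 'm, 'z) category_scheme \<Rightarrow> 'o \<Rightarrow> 'o \<Rightarrow> 'm set" where
  "mor C x y \<equiv> carrier (Mor C x y)"

definition iso_mor :: "('r, 'o, 'm, 'z) category_scheme \<Rightarrow> 'o \<Rightarrow> 'o \<Rightarrow> 'm \<Rightarrow> bool" where
  "iso_mor C x y f \<longleftrightarrow>
     f \<in> mor C x y \<and> (\<exists>g\<in>mor C y x. g \<cdot>\<^bsub>C\<^esub> f = ident C x \<and> f \<cdot>\<^bsub>C\<^esub> g = ident C y)"

definition iso_ob :: "('r, 'o, 'm, 'z) category_scheme \<Rightarrow> 'o \<Rightarrow> 'o \<Rightarrow> bool" where
  "iso_ob C x y \<longleftrightarrow> x \<in> Ob C \<and> y \<in> Ob C \<and> (\<exists>f. iso_mor C x y f)"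

definition zero_ob :: "('r, 'o, 'm, 'z) category_scheme \<Rightarrow> 'o \<Rightarrow> bool" where
  "zero_ob C z \<longleftrightarrow> z \<in> Ob C \<and> (\<forall>x\<in>Ob C. (\<exists>!f. f \<in> mor C x z) \<and> (\<exists>!f. f \<in> mor C z x))"

definition biproduct :: "('r, 'o, 'm, 'z) category_scheme \<Rightarrow> 'o \<Rightarrow> 'o \<Rightarrow> 'o \<Rightarrow> bool" where
  "biproduct C x y s \<longleftrightarrow> s \<in> Ob C \<and>
     (\<exists>i\<in>mor C x s. \<exists>j\<in>mor C y s. \<exists>p\<in>mor C s x. \<exists>q\<in>mor C s y.
        p \<cdot>\<^bsub>C\<^esub> i = ident C x \<and> q \<cdot>\<^bsub>C\<^esub> j = ident C y \<and>
        p \<cdot>\<^bsub>C\<^esub> j = \<zero>\<^bsub>Mor C y x\<^esub> \<and> q \<cdot>\<^bsub>C\<^esub> i = \<zero>\<^bsub>Mor C x y\<^esub> \<and>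
        (i \<cdot>\<^bsub>C\<^esub> p) \<oplus>\<^bsub>Mor C s s\<^esub> (j \<cdot>\<^bsub>C\<^esub> q) = ident C s)"

definition idempotent_complete :: "('r, 'o, 'm, 'z) category_scheme \<Rightarrow> bool" where
  "idempotent_complete C \<longleftrightarrow>
     (\<forall>x\<in>Ob C. \<forall>e\<in>mor C x x. e \<cdot>\<^bsub>C\<^esub> e = e \<longrightarrow>
        (\<exists>y\<in>Ob C. \<exists>p\<in>mor C x y. \<exists>i\<in>mor C y x. i \<cdot>\<^bsub>C\<^esub> p = e \<and> p \<cdot>\<^bsub>C\<^esub> i = ident C y))"

locale linear_category =
  fixes C :: "('r::comm_ring_1, 'o, 'm, 'z) category_scheme" (structure)
  assumes hom_module:
      "\<lbrakk>x \<in> Ob C; y \<in> Ob C\<rbrakk> \<Longrightarrow> module (ring_of_type_algebra :: 'r ring) (Mor C x y)"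
    and ident_mor: "x \<in> Ob C \<Longrightarrow> ident C x \<in> mor C x x"
    and cmp_mor:
      "\<lbrakk>x \<in> Ob C; y \<in> Ob C; z \<in> Ob C; f \<in> mor C x y; g \<in> mor C y z\<rbrakk> \<Longrightarrow> g \<cdot> f \<in> mor C x z"
    and ident_right: "\<lbrakk>x \<in> Ob C; y \<in> Ob C; f \<in> mor C x y\<rbrakk> \<Longrightarrow> f \<cdot> ident C x = f"
    and ident_left: "\<lbrakk>x \<in> Ob C; y \<in> Ob C; f \<in> mor C x y\<rbrakk> \<Longrightarrow> ident C y \<cdot> f = f"
    and cmp_assoc:
      "\<lbrakk>w \<in> Ob C; x \<in> Ob C; y \<in> Ob C; z \<in> Ob C; f \<in> mor C w x; g \<in> mor C x y; h \<in> mor C y z\<rbrakk>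
        \<Longrightarrow> h \<cdot> (g \<cdot> f) = (h \<cdot> g) \<cdot> f"
    and cmp_linear_left:
      "\<lbrakk>x \<in> Ob C; y \<in> Ob C; z \<in> Ob C; g \<in> mor C y z\<rbrakk>
        \<Longrightarrow> linear_map (Mor C x y) (Mor C x z) (\<lambda>f. g \<cdot> f)"
    and cmp_linear_right:
      "\<lbrakk>x \<in> Ob C; y \<in> Ob C; z \<in> Ob C; f \<in> mor C x y\<rbrakk>
        \<Longrightarrow> linear_map (Mor C y z) (Mor C x z) (\<lambda>g. g \<cdot> f)"

locale additive_category = linear_category +
  assumes has_zero_ob: "\<exists>z. zero_ob C z"
    and has_biproducts: "\<lbrakk>x \<in> Ob C; y \<in> Ob C\<rbrakk> \<Longrightarrow> \<exists>s. biproduct C x y s"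

definition linear_functor ::
  "('r::comm_ring_1, 'o, 'm, 'z) category_scheme \<Rightarrow> ('r, 'p, 'n, 'y) category_scheme
     \<Rightarrow> ('o \<Rightarrow> 'p) \<Rightarrow> ('m \<Rightarrow> 'n) \<Rightarrow> bool" where
  "linear_functor C D Fo Fm \<longleftrightarrow>
     (\<forall>x\<in>Ob C. Fo x \<in> Ob D \<and> Fm (ident C x) = ident D (Fo x)) \<and>
     (\<forall>x\<in>Ob C. \<forall>y\<in>Ob C. linear_map (Mor C x y) (Mor D (Fo x) (Fo y)) Fm) \<and>
     (\<forall>x\<in>Ob C. \<forall>y\<in>Ob C. \<forall>z\<in>Ob C. \<forall>f\<in>mor C x y. \<forall>g\<in>mor C y z.
        Fm (g \<cdot>\<^bsub>C\<^esub> f) = Fm g \<cdot>\<^bsub>D\<^esub> Fm f)"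

text \<open>
  \<open>sh\<close> and \<open>shm\<close> are the shift \<open>[1]\<close> on objects and on morphisms; \<open>dtri C x y z f g h\<close> says that
  \<open>x \<rightarrow> y \<rightarrow> z \<rightarrow> x[1]\<close> with maps \<open>f\<close>, \<open>g\<close>, \<open>h\<close> is an exact (distinguished) triangle.
\<close>

record ('r, 'o, 'm) tri_category = "('r, 'o, 'm) category" +
  sh :: "'o \<Rightarrow> 'o"
  shm :: "'m \<Rightarrow> 'm"
  dtri :: "'o \<Rightarrow> 'o \<Rightarrow> 'o \<Rightarrow> 'm \<Rightarrow> 'm \<Rightarrow> 'm \<Rightarrow> bool"

text \<open>The shift is an automorphism (not merely an autoequivalence), as in Verdier's definition.\<close>

locale triangulated_category = additive_category C
  for C :: "('r::comm_ring_1, 'o, 'm, 'z) tri_category_scheme" (structure) +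
  assumes sh_functor: "linear_functor C C (sh C) (shm C)"
    and sh_bij: "bij_betw (sh C) (Ob C) (Ob C)"
    and shm_bij:
      "\<lbrakk>x \<in> Ob C; y \<in> Ob C\<rbrakk> \<Longrightarrow> bij_betw (shm C) (mor C x y) (mor C (sh C x) (sh C y))"
    and dtri_mor:
      "dtri C x y z f g h \<Longrightarrow>
         x \<in> Ob C \<and> y \<in> Ob C \<and> z \<in> Ob C \<and> f \<in> mor C x y \<and> g \<in> mor C y z \<and> h \<in> mor C z (sh C x)"
    and TR1_ident:
      "\<lbrakk>x \<in> Ob C; zero_ob C z\<rbrakk>
        \<Longrightarrow> dtri C x x z (ident C x) \<zero>\<^bsub>Mor C x z\<^esub> \<zero>\<^bsub>Mor C z (sh C x)\<^esub>"
    and TR1_iso: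
      "\<lbrakk>dtri C x y z f g h; x' \<in> Ob C; y' \<in> Ob C; z' \<in> Ob C;
        f' \<in> mor C x' y'; g' \<in> mor C y' z'; h' \<in> mor C z' (sh C x');
        iso_mor C x x' a; iso_mor C y y' b; iso_mor C z z' c;
        f' \<cdot> a = b \<cdot> f; g' \<cdot> b = c \<cdot> g; h' \<cdot> c = shm C a \<cdot> h\<rbrakk>
        \<Longrightarrow> dtri C x' y' z' f' g' h'"
    and TR1_cone:
      "\<lbrakk>x \<in> Ob C; y \<in> Ob C; f \<in> mor C x y\<rbrakk> \<Longrightarrow> \<exists>z g h. dtri C x y z f g h"
    and TR2:
      "\<lbrakk>x \<in> Ob C; y \<in> Ob C; z \<in> Ob C; f \<in> mor C x y; g \<in> mor C y z; h \<in> mor C z (sh C x)\<rbrakk>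
        \<Longrightarrow> dtri C x y z f g h \<longleftrightarrow>
            dtri C y z (sh C x) g h (\<ominus>\<^bsub>Mor C (sh C x) (sh C y)\<^esub> shm C f)"
    and TR3:
      "\<lbrakk>dtri C x y z f g h; dtri C x' y' z' f' g' h';
        a \<in> mor C x x'; b \<in> mor C y y'; f' \<cdot> a = b \<cdot> f\<rbrakk>
        \<Longrightarrow> \<exists>c\<in>mor C z z'. g' \<cdot> b = c \<cdot> g \<and> h' \<cdot> c = shm C a \<cdot> h"
    and TR4:
      "\<lbrakk>dtri C x y u f i i'; dtri C y z w g j j'; dtri C x z v (g \<cdot> f) k k'\<rbrakk>
        \<Longrightarrow> \<exists>a b. dtri C u v w a b (shm C i \<cdot> j') \<and>
              a \<cdot> i = k \<cdot> g \<and> k' \<cdot> a = i' \<and> b \<cdot> k = j \<and> j' \<cdot> b = shm C f \<cdot> k'"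

definition shift :: "('r, 'o, 'm, 'z) tri_category_scheme \<Rightarrow> 'o \<Rightarrow> int \<Rightarrow> 'o" where
  "shift C x n =
     (if 0 \<le> n then (sh C ^^ nat n) x else (inv_into (Ob C) (sh C) ^^ nat (- n)) x)"

definition exact_functor ::
  "('r::comm_ring_1, 'o, 'm, 'z) tri_category_scheme \<Rightarrow> ('r, 'p, 'n, 'y) tri_category_scheme
     \<Rightarrow> ('o \<Rightarrow> 'p) \<Rightarrow> ('m \<Rightarrow> 'n) \<Rightarrow> bool" where
  "exact_functor C D Fo Fm \<longleftrightarrow> linear_functor C D Fo Fm \<and>
     (\<exists>\<phi>. (\<forall>x\<in>Ob C. iso_mor D (Fo (sh C x)) (sh D (Fo x)) (\<phi> x)) \<and>
          (\<forall>x\<in>Ob C. \<forall>y\<in>Ob C. \<forall>f\<in>mor C x y.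
             \<phi> y \<cdot>\<^bsub>D\<^esub> Fm (shm C f) = shm D (Fm f) \<cdot>\<^bsub>D\<^esub> \<phi> x) \<and>
          (\<forall>x y z f g h. dtri C x y z f g h \<longrightarrow>
             dtri D (Fo x) (Fo y) (Fo z) (Fm f) (Fm g) (\<phi> x \<cdot>\<^bsub>D\<^esub> Fm h)))"


section \<open>Triangulated 2-categories\<close>

text \<open>
  The objects of the category \<open>HomCat K a b\<close> are the 1-morphisms from \<open>a\<close> to \<open>b\<close>, its morphisms are
  the 2-morphisms, and its composition is the vertical one. \<open>cmp1\<close> and \<open>hcmp\<close> are the (horizontal)
  compositions of 1-morphisms and of 2-morphisms.
\<close>

record ('o, 'f, 'm) two_category =
  Ob2 :: "'o set"
  HomCat :: "'o \<Rightarrow> 'o \<Rightarrow> (complex, 'f, 'm) tri_category"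
  cmp1 :: "'f \<Rightarrow> 'f \<Rightarrow> 'f"  (infixr \<open>\<diamondop>\<index>\<close> 75)
  hcmp :: "'m \<Rightarrow> 'm \<Rightarrow> 'm"  (infixr \<open>\<star>\<index>\<close> 75)
  one1 :: "'o \<Rightarrow> 'f"

abbreviation ident2 :: "('o, 'f, 'm, 'z) two_category_scheme \<Rightarrow> 'o \<Rightarrow> 'o \<Rightarrow> 'f \<Rightarrow> 'm" where
  "ident2 K a b f \<equiv> ident (HomCat K a b) f"

text \<open>
  A strict 2-category, \<open>\<complex>\<close>-linear, with triangulated idempotent complete categories of 1-morphisms
  and composition exact in each variable.
\<close>

locale triangulated_2category =
  fixes K :: "('o, 'f, 'm, 'z) two_category_scheme" (structure)
  assumes HomCat_triangulated:
      "\<lbrakk>a \<in> Ob2 K; b \<in> Ob2 K\<rbrakk> \<Longrightarrow> triangulated_category (HomCat K a b)"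
    and HomCat_idempotent_complete:
      "\<lbrakk>a \<in> Ob2 K; b \<in> Ob2 K\<rbrakk> \<Longrightarrow> idempotent_complete (HomCat K a b)"
    and one1_Ob: "a \<in> Ob2 K \<Longrightarrow> one1 K a \<in> Ob (HomCat K a a)"
    and cmp1_Ob:
      "\<lbrakk>a \<in> Ob2 K; b \<in> Ob2 K; c \<in> Ob2 K; f \<in> Ob (HomCat K a b); g \<in> Ob (HomCat K b c)\<rbrakk>
        \<Longrightarrow> g \<diamondop> f \<in> Ob (HomCat K a c)"
    and hcmp_mor:
      "\<lbrakk>a \<in> Ob2 K; b \<in> Ob2 K; c \<in> Ob2 K;
        f \<in> Ob (HomCat K a b); f' \<in> Ob (HomCat K a b);
        g \<in> Ob (HomCat K b c); g' \<in> Ob (HomCat K b c);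
        s \<in> mor (HomCat K a b) f f'; t \<in> mor (HomCat K b c) g g'\<rbrakk>
        \<Longrightarrow> t \<star> s \<in> mor (HomCat K a c) (g \<diamondop> f) (g' \<diamondop> f')"
    and cmp1_one_right:
      "\<lbrakk>a \<in> Ob2 K; b \<in> Ob2 K; f \<in> Ob (HomCat K a b)\<rbrakk> \<Longrightarrow> f \<diamondop> one1 K a = f"
    and cmp1_one_left:
      "\<lbrakk>a \<in> Ob2 K; b \<in> Ob2 K; f \<in> Ob (HomCat K a b)\<rbrakk> \<Longrightarrow> one1 K b \<diamondop> f = f"
    and cmp1_assoc:
      "\<lbrakk>a \<in> Ob2 K; b \<in> Ob2 K; c \<in> Ob2 K; d \<in> Ob2 K;
        f \<in> Ob (HomCat K a b); g \<in> Ob (HomCat K b c); h \<in> Ob (HomCat K c d)\<rbrakk>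
        \<Longrightarrow> h \<diamondop> (g \<diamondop> f) = (h \<diamondop> g) \<diamondop> f"
    and hcmp_one_right:
      "\<lbrakk>a \<in> Ob2 K; b \<in> Ob2 K; f \<in> Ob (HomCat K a b); f' \<in> Ob (HomCat K a b);
        s \<in> mor (HomCat K a b) f f'\<rbrakk>
        \<Longrightarrow> s \<star> ident2 K a a (one1 K a) = s"
    and hcmp_one_left:
      "\<lbrakk>a \<in> Ob2 K; b \<in> Ob2 K; f \<in> Ob (HomCat K a b); f' \<in> Ob (HomCat K a b);
        s \<in> mor (HomCat K a b) f f'\<rbrakk>
        \<Longrightarrow> ident2 K b b (one1 K b) \<star> s = s"
    and hcmp_assoc:
      "\<lbrakk>a \<in> Ob2 K; b \<in> Ob2 K; c \<in> Ob2 K; d \<in> Ob2 K;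
        f \<in> Ob (HomCat K a b); f' \<in> Ob (HomCat K a b);
        g \<in> Ob (HomCat K b c); g' \<in> Ob (HomCat K b c);
        h \<in> Ob (HomCat K c d); h' \<in> Ob (HomCat K c d);
        s \<in> mor (HomCat K a b) f f'; t \<in> mor (HomCat K b c) g g'; u \<in> mor (HomCat K c d) h h'\<rbrakk>
        \<Longrightarrow> u \<star> (t \<star> s) = (u \<star> t) \<star> s"
    and hcmp_ident:
      "\<lbrakk>a \<in> Ob2 K; b \<in> Ob2 K; c \<in> Ob2 K; f \<in> Ob (HomCat K a b); g \<in> Ob (HomCat K b c)\<rbrakk>
        \<Longrightarrow> ident2 K b c g \<star> ident2 K a b f = ident2 K a c (g \<diamondop> f)"
    and interchange:
      "\<lbrakk>a \<in> Ob2 K; b \<in> Ob2 K; c \<in> Ob2 K;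
        f \<in> Ob (HomCat K a b); f' \<in> Ob (HomCat K a b); f'' \<in> Ob (HomCat K a b);
        g \<in> Ob (HomCat K b c); g' \<in> Ob (HomCat K b c); g'' \<in> Ob (HomCat K b c);
        s \<in> mor (HomCat K a b) f f'; s' \<in> mor (HomCat K a b) f' f'';
        t \<in> mor (HomCat K b c) g g'; t' \<in> mor (HomCat K b c) g' g''\<rbrakk>
        \<Longrightarrow> (t' \<cdot>\<^bsub>HomCat K b c\<^esub> t) \<star> (s' \<cdot>\<^bsub>HomCat K a b\<^esub> s)
            = (t' \<star> s') \<cdot>\<^bsub>HomCat K a c\<^esub> (t \<star> s)"
    and cmp1_exact_left:
      "\<lbrakk>a \<in> Ob2 K; b \<in> Ob2 K; c \<in> Ob2 K; g \<in> Ob (HomCat K b c)\<rbrakk>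
        \<Longrightarrow> exact_functor (HomCat K a b) (HomCat K a c) (\<lambda>f. g \<diamondop> f) (\<lambda>s. ident2 K b c g \<star> s)"
    and cmp1_exact_right:
      "\<lbrakk>a \<in> Ob2 K; b \<in> Ob2 K; c \<in> Ob2 K; f \<in> Ob (HomCat K a b)\<rbrakk>
        \<Longrightarrow> exact_functor (HomCat K b c) (HomCat K a c) (\<lambda>g. g \<diamondop> f) (\<lambda>t. t \<star> ident2 K a b f)"

definition right_adjoint :: "('o, 'f, 'm, 'z) two_category_scheme \<Rightarrow> 'o \<Rightarrow> 'o \<Rightarrow> 'f \<Rightarrow> 'f \<Rightarrow> bool" where
  "right_adjoint K a b f g \<longleftrightarrow> f \<in> Ob (HomCat K a b) \<and> g \<in> Ob (HomCat K b a) \<and>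
     (\<exists>\<eta>\<in>mor (HomCat K a a) (one1 K a) (g \<diamondop>\<^bsub>K\<^esub> f).
      \<exists>\<epsilon>\<in>mor (HomCat K b b) (f \<diamondop>\<^bsub>K\<^esub> g) (one1 K b).
        (\<epsilon> \<star>\<^bsub>K\<^esub> ident2 K a b f) \<cdot>\<^bsub>HomCat K a b\<^esub> (ident2 K a b f \<star>\<^bsub>K\<^esub> \<eta>) = ident2 K a b f \<and>
        (ident2 K b a g \<star>\<^bsub>K\<^esub> \<epsilon>) \<cdot>\<^bsub>HomCat K b a\<^esub> (\<eta> \<star>\<^bsub>K\<^esub> ident2 K b a g) = ident2 K b a g)"

text \<open>Integer powers of an endo-1-morphism \<open>f\<close> of \<open>a\<close> with chosen inverse \<open>f'\<close>.\<close>

definition power1 :: "('o, 'f, 'm, 'z) two_category_scheme \<Rightarrow> 'o \<Rightarrow> 'f \<Rightarrow> 'f \<Rightarrow> int \<Rightarrow> 'f" where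
  "power1 K a f f' n =
     (if 0 \<le> n then ((\<lambda>g. f \<diamondop>\<^bsub>K\<^esub> g) ^^ nat n) (one1 K a)
      else ((\<lambda>g. f' \<diamondop>\<^bsub>K\<^esub> g) ^^ nat (- n)) (one1 K a))"


section \<open>Partial categorical actions\<close>

text \<open>
  A weight \<open>k = (k1, k2)\<close> is a pair of integers. In \<open>Efun K r k\<close> (the 1-morphism \<open>E\<^sub>r 1\<^sub>k\<close>) and all other
  1-morphisms, \<open>k\<close> is the weight of the source. The 1-morphisms \<open>PsiP\<close>, \<open>PsiM\<close>, \<open>PsiP'\<close>, \<open>PsiM'\<close>, \<open>H1\<close>,
  \<open>H1'\<close> are \<open>\<Psi>\<^sup>+\<close>, \<open>\<Psi>\<^sup>-\<close>, their inverses, and \<open>H\<^sub>1\<close>, \<open>H\<close> with index \<open>-1\<close>. The objects \<open>wcat K k\<close> of the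
  2-category are themselves triangulated categories (over the integers, i.e. no linearity beyond
  additivity is imposed on them), while the Hom-categories are \<open>\<complex>\<close>-linear.
\<close>

record ('x, 'y, 'f, 'm) sl2_data = "((int, 'x, 'y) tri_category, 'f, 'm) two_category" +
  wcat :: "int \<times> int \<Rightarrow> (int, 'x, 'y) tri_category"
  Efun :: "int \<Rightarrow> int \<times> int \<Rightarrow> 'f"
  Ffun :: "int \<Rightarrow> int \<times> int \<Rightarrow> 'f"
  PsiP :: "int \<times> int \<Rightarrow> 'f"
  PsiP' :: "int \<times> int \<Rightarrow> 'f"
  PsiM :: "int \<times> int \<Rightarrow> 'f"
  PsiM' :: "int \<times> int \<Rightarrow> 'f"
  H1 :: "int \<times> int \<Rightarrow> 'f"
  H1' :: "int \<times> int \<Rightarrow> 'f"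

definition weights :: "nat \<Rightarrow> (int \<times> int) set" where
  "weights N = {(k1, k2). 0 \<le> k1 \<and> 0 \<le> k2 \<and> k1 + k2 = int N}"

text \<open>All weights \<open>k + r \<alpha>\<close> (\<open>r\<close> an integer) with \<open>k\<close> in \<open>weights N\<close>.\<close>

definition weight_line :: "nat \<Rightarrow> (int \<times> int) set" where
  "weight_line N = {(k1, k2). k1 + k2 = int N}"

abbreviation Hm :: "('x, 'y, 'f, 'm, 'z) sl2_data_scheme \<Rightarrow> int \<times> int \<Rightarrow> int \<times> int
    \<Rightarrow> (complex, 'f, 'm) tri_category" where
  "Hm K k l \<equiv> HomCat K (wcat K k) (wcat K l)"

abbreviation one_wt :: "('x, 'y, 'f, 'm, 'z) sl2_data_scheme \<Rightarrow> int \<times> int \<Rightarrow> 'f" where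
  "one_wt K k \<equiv> one1 K (wcat K k)"

abbreviation PsiP_pow :: "('x, 'y, 'f, 'm, 'z) sl2_data_scheme \<Rightarrow> int \<times> int \<Rightarrow> int \<Rightarrow> 'f" where
  "PsiP_pow K k n \<equiv> power1 K (wcat K k) (PsiP K k) (PsiP' K k) n"

abbreviation PsiM_pow :: "('x, 'y, 'f, 'm, 'z) sl2_data_scheme \<Rightarrow> int \<times> int \<Rightarrow> int \<Rightarrow> 'f" where
  "PsiM_pow K k n \<equiv> power1 K (wcat K k) (PsiM K k) (PsiM' K k) n"

text \<open>
  Weights outside \<open>weights N\<close> are kept as objects whose identity 1-morphism is zero; every
  1-morphism through such an object is then zero, since composition is additive. In this way a
  composite such as \<open>F\<^sub>s E\<^sub>r 1\<^sub>k\<close> passing through an outside weight denotes a zero 1-morphism.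
\<close>

locale partial_sl2_action = triangulated_2category K
  for N :: nat and K :: "('x, 'y, 'f, 'm, 'z) sl2_data_scheme" (structure) +
  assumes objects: "Ob2 K = wcat K ` weight_line N"
    and objects_triangulated: "k \<in> weights N \<Longrightarrow> triangulated_category (wcat K k)"
    and outside_zero: "k \<in> weight_line N - weights N \<Longrightarrow> zero_ob (Hm K k k) (one_wt K k)"
    and Efun_Ob:
      "\<lbrakk>(k1, k2) \<in> weight_line N; - k1 - 1 \<le> r; r \<le> 0\<rbrakk>
        \<Longrightarrow> Efun K r (k1, k2) \<in> Ob (Hm K (k1, k2) (k1 - 1, k2 + 1))"
    and Ffun_Ob:
      "\<lbrakk>(k1, k2) \<in> weight_line N; 0 \<le> s; s \<le> k2 + 1\<rbrakk>
        \<Longrightarrow> Ffun K s (k1, k2) \<in> Ob (Hm K (k1, k2) (k1 + 1, k2 - 1))"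
    and Psi_Ob:
      "k \<in> weight_line N \<Longrightarrow> PsiP K k \<in> Ob (Hm K k k) \<and> PsiP' K k \<in> Ob (Hm K k k) \<and>
                              PsiM K k \<in> Ob (Hm K k k) \<and> PsiM' K k \<in> Ob (Hm K k k)"
    and H_Ob: "k \<in> weight_line N \<Longrightarrow> H1 K k \<in> Ob (Hm K k k) \<and> H1' K k \<in> Ob (Hm K k k)"
    and PsiP_inverse:
      "k \<in> weights N \<Longrightarrow> iso_ob (Hm K k k) (PsiP K k \<diamondop> PsiP' K k) (one_wt K k) \<and>
                           iso_ob (Hm K k k) (PsiP' K k \<diamondop> PsiP K k) (one_wt K k)"
    and PsiM_inverse:
      "k \<in> weights N \<Longrightarrow> iso_ob (Hm K k k) (PsiM K k \<diamondop> PsiM' K k) (one_wt K k) \<and>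
                           iso_ob (Hm K k k) (PsiM' K k \<diamondop> PsiM K k) (one_wt K k)"
    and finite_dim:
      "\<lbrakk>a \<in> Ob2 K; b \<in> Ob2 K; f \<in> Ob (HomCat K a b); g \<in> Ob (HomCat K a b)\<rbrakk>
        \<Longrightarrow> finite_dimensional (Mor (HomCat K a b) f g)"
    and integrable:
      "(k1, k2) \<in> weights N \<Longrightarrow>
         \<exists>R. \<forall>r. \<bar>r\<bar> > R \<longrightarrow> zero_ob (Hm K (k1 - r, k2 + r) (k1 - r, k2 + r)) (one_wt K (k1 - r, k2 + r))"
    and E_right_adjoint:
      "\<lbrakk>(k1, k2) \<in> weights N; - k1 - 1 \<le> r; r \<le> 0\<rbrakk> \<Longrightarrow>
         \<exists>G. right_adjoint K (wcat K (k1, k2)) (wcat K (k1 - 1, k2 + 1)) (Efun K r (k1, k2)) G \<and>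
             iso_ob (Hm K (k1 - 1, k2 + 1) (k1, k2)) G
               (shift (Hm K (k1 - 1, k2 + 1) (k1, k2))
                  (PsiP_pow K (k1, k2) (r + 1) \<diamondop> Ffun K (k2 + 2) (k1 - 1, k2 + 1)
                     \<diamondop> PsiP_pow K (k1 - 1, k2 + 1) (- r - 2))
                  (- r - 1))"
    and F_right_adjoint:
      "\<lbrakk>(k1, k2) \<in> weights N; 0 \<le> s; s \<le> k2 + 1\<rbrakk> \<Longrightarrow>
         \<exists>G. right_adjoint K (wcat K (k1, k2)) (wcat K (k1 + 1, k2 - 1)) (Ffun K s (k1, k2)) G \<and>
             iso_ob (Hm K (k1 + 1, k2 - 1) (k1, k2)) G
               (shift (Hm K (k1 + 1, k2 - 1) (k1, k2))
                  (PsiM_pow K (k1, k2) (- s + 1) \<diamondop> Efun K (- k1 - 2) (k1 + 1, k2 - 1)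
                     \<diamondop> PsiM_pow K (k1 + 1, k2 - 1) (s - 2))
                  (s - 1))"
    and Psi_E:
      "\<lbrakk>(k1, k2) \<in> weights N; - k1 - 1 \<le> r; r + 1 \<le> 0\<rbrakk> \<Longrightarrow>
         iso_ob (Hm K (k1, k2) (k1 - 1, k2 + 1))
           (PsiP K (k1 - 1, k2 + 1) \<diamondop> Efun K r (k1, k2))
           (shift (Hm K (k1, k2) (k1 - 1, k2 + 1)) (Efun K (r + 1) (k1, k2) \<diamondop> PsiP K (k1, k2)) (- 1)) \<and>
         iso_ob (Hm K (k1, k2) (k1 - 1, k2 + 1))
           (PsiM K (k1 - 1, k2 + 1) \<diamondop> Efun K r (k1, k2))
           (shift (Hm K (k1, k2) (k1 - 1, k2 + 1)) (Efun K (r + 1) (k1, k2) \<diamondop> PsiM K (k1, k2)) 1)"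
    and Psi_F:
      "\<lbrakk>(k1, k2) \<in> weights N; 0 \<le> s - 1; s \<le> k2 + 1\<rbrakk> \<Longrightarrow>
         iso_ob (Hm K (k1, k2) (k1 + 1, k2 - 1))
           (PsiP K (k1 + 1, k2 - 1) \<diamondop> Ffun K s (k1, k2))
           (shift (Hm K (k1, k2) (k1 + 1, k2 - 1)) (Ffun K (s - 1) (k1, k2) \<diamondop> PsiP K (k1, k2)) 1) \<and>
         iso_ob (Hm K (k1, k2) (k1 + 1, k2 - 1))
           (PsiM K (k1 + 1, k2 - 1) \<diamondop> Ffun K s (k1, k2))
           (shift (Hm K (k1, k2) (k1 + 1, k2 - 1)) (Ffun K (s - 1) (k1, k2) \<diamondop> PsiM K (k1, k2)) (- 1))"
    and triangle_PsiP:
      "\<lbrakk>(k1, k2) \<in> weights N; - k1 - 1 \<le> r; r \<le> 0; 0 \<le> s; s \<le> k2 + 1; r + s = k2\<rbrakk> \<Longrightarrow>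
         \<exists>u v w. dtri (Hm K (k1, k2) (k1, k2))
           (Ffun K s (k1 - 1, k2 + 1) \<diamondop> Efun K r (k1, k2))
           (Efun K r (k1 + 1, k2 - 1) \<diamondop> Ffun K s (k1, k2))
           (PsiP K (k1, k2)) u v w"
    and triangle_PsiM:
      "\<lbrakk>(k1, k2) \<in> weights N; - k1 - 1 \<le> r; r \<le> 0; 0 \<le> s; s \<le> k2 + 1; r + s = - k1\<rbrakk> \<Longrightarrow>
         \<exists>u v w. dtri (Hm K (k1, k2) (k1, k2))
           (Efun K r (k1 + 1, k2 - 1) \<diamondop> Ffun K s (k1, k2))
           (Ffun K s (k1 - 1, k2 + 1) \<diamondop> Efun K r (k1, k2))
           (PsiM K (k1, k2)) u v w"
    and E_F_commute:
      "\<lbrakk>(k1, k2) \<in> weights N; - k1 - 1 \<le> r; r \<le> 0; 0 \<le> s; s \<le> k2 + 1;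
        - k1 + 1 \<le> r + s; r + s \<le> k2 - 1\<rbrakk> \<Longrightarrow>
         iso_ob (Hm K (k1, k2) (k1, k2))
           (Ffun K s (k1 - 1, k2 + 1) \<diamondop> Efun K r (k1, k2))
           (Efun K r (k1 + 1, k2 - 1) \<diamondop> Ffun K s (k1, k2))"


section \<open>The 1-morphisms indexed by partitions\<close>

definition partitions_in :: "nat \<Rightarrow> nat \<Rightarrow> int list set" where
  "partitions_in a b =
     {\<mu>. length \<mu> = b \<and> sorted_wrt (\<ge>) \<mu> \<and> (\<forall>m\<in>set \<mu>. 0 \<le> m \<and> m \<le> int a)}"

definition lex_less :: "int list \<Rightarrow> int list \<Rightarrow> bool" where
  "lex_less \<mu> \<mu>' \<longleftrightarrow>
     (\<exists>j. j < length \<mu> \<and> j < length \<mu>' \<and> (\<forall>i<j. \<mu> ! i = \<mu>' ! i) \<and> \<mu> ! j < \<mu>' ! j)"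

text \<open>
  \<open>E_minus K N \<mu>\<close> goes from weight \<open>(N, 0)\<close> to weight \<open>(N - length \<mu>, length \<mu>)\<close>; the last entry of
  \<open>\<mu>\<close> is applied first.
\<close>

primrec E_minus :: "('x, 'y, 'f, 'm, 'z) sl2_data_scheme \<Rightarrow> nat \<Rightarrow> int list \<Rightarrow> 'f" where
  "E_minus K N [] = one_wt K (int N, 0)"
| "E_minus K N (m # \<mu>) =
     Efun K (- m) (int N - int (length \<mu>), int (length \<mu>)) \<diamondop>\<^bsub>K\<^esub> E_minus K N \<mu>"

end

theory Submission
  imports Defs
begin

text \<open>
  Everything is deduced from one computation. Write weights as \<open>(N - i, i)\<close>. The right adjoint of
  \<open>E\<close> with index \<open>-m\<close> at this weight is, up to powers of \<open>\<Psi>\<^sup>+\<close> and shifts, \<open>F\<close> with index \<open>i + 1\<close>, and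
  sliding the powers of \<open>\<Psi>\<^sup>+\<close> past \<open>E\<close> shows (\<open>E_adjoint_E\<close>) that the adjoint composed with \<open>E\<close> of
  index \<open>r\<close> is \<open>(\<Psi>\<^sup>+)^(-m) F_(i+1) E_(r+m-1) (\<Psi>\<^sup>+)^(m-1) [1]\<close>.
  The indices of \<open>F\<close> and \<open>E\<close> add up to \<open>i + r + m\<close>, so the axioms can be applied in two cases.

  If \<open>r < -m\<close> and \<open>r + m > -N\<close>, then \<open>F\<close> and \<open>E\<close> commute, and the composite factors through an \<open>E\<close>
  starting one weight closer to \<open>(N, 0)\<close>. This shows (\<open>E_minus_orthogonal\<close>) that there are no maps from \<open>E_(-\<nu>)\<close> to any
  shift of a 1-morphism \<open>E_(-n) Y\<close> when all entries of \<open>\<nu>\<close> are smaller than \<open>n\<close> and \<open>n\<close> is at most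
  the first coordinate of the weight reached by \<open>E_(-\<nu>)\<close>: by adjunction the entries of \<open>\<nu>\<close> are removed
  one by one, each removal raising \<open>n\<close> by one, until the target factors through the weight \<open>(N + 1, -1)\<close>,
  where every 1-morphism is zero.

  If \<open>r = -m\<close>, there is an exact triangle from \<open>F E\<close> to \<open>E F\<close> to \<open>\<Psi>\<^sup>+\<close>. After conjugation by powers of
  \<open>\<Psi>\<^sup>+\<close>, its third term is the identity, and its middle term has the form \<open>E_(-m-1) Y'\<close> up to shift,
  to which a composite of \<open>E\<close>'s with entries at most \<open>m\<close> has no maps by the first case. Therefore
  (\<open>E_hom_cancel\<close>) \<open>Hom(E_(-m) X, E_(-m) Y) \<cong> Hom(X, Y)\<close> for such a composite \<open>X\<close>.

  Cancelling all entries of \<open>\<mu>\<close> computes its endomorphisms. For \<open>\<mu>\<close> lexicographically smaller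
  than \<open>\<mu>'\<close>, cancelling the common initial entries leaves a first entry of \<open>\<mu>'\<close> which exceeds all
  entries of \<open>\<mu>\<close>, because \<open>\<mu>\<close> is decreasing, and the first case gives the vanishing.
\<close>


section \<open>Linear maps\<close>

lemma linear_map_closed: "linear_map V W \<phi> \<Longrightarrow> v \<in> carrier V \<Longrightarrow> \<phi> v \<in> carrier W"
  by (auto simp: linear_map_def)

lemma linear_map_add:
  "linear_map V W \<phi> \<Longrightarrow> u \<in> carrier V \<Longrightarrow> v \<in> carrier V \<Longrightarrow> \<phi> (u \<oplus>\<^bsub>V\<^esub> v) = \<phi> u \<oplus>\<^bsub>W\<^esub> \<phi> v"
  by (auto simp: linear_map_def)

lemma linear_map_smult:
  "linear_map V W \<phi> \<Longrightarrow> v \<in> carrier V \<Longrightarrow> \<phi> (c \<odot>\<^bsub>V\<^esub> v) = c \<odot>\<^bsub>W\<^esub> \<phi> v"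
  by (auto simp: linear_map_def)

lemma linear_map_zero:
  assumes "linear_map V W \<phi>" "abelian_group V" "abelian_group W"
  shows "\<phi> \<zero>\<^bsub>V\<^esub> = \<zero>\<^bsub>W\<^esub>"
proof -
  interpret V: abelian_group V by fact
  interpret W: abelian_group W by fact
  have c: "\<phi> \<zero>\<^bsub>V\<^esub> \<in> carrier W"
    by (rule linear_map_closed[OF assms(1) V.zero_closed])
  have "\<phi> \<zero>\<^bsub>V\<^esub> \<oplus>\<^bsub>W\<^esub> \<phi> \<zero>\<^bsub>V\<^esub> = \<phi> \<zero>\<^bsub>V\<^esub>"
    using linear_map_add[OF assms(1), of "\<zero>\<^bsub>V\<^esub>" "\<zero>\<^bsub>V\<^esub>"] by simp
  then show ?thesis using c W.add.r_cancel_one by simp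
qed

lemma linear_map_minus:
  assumes "linear_map V W \<phi>" "abelian_group V" "abelian_group W" "v \<in> carrier V"
  shows "\<phi> (\<ominus>\<^bsub>V\<^esub> v) = \<ominus>\<^bsub>W\<^esub> \<phi> v"
proof -
  interpret V: abelian_group V by fact
  interpret W: abelian_group W by fact
  have "\<phi> (\<ominus>\<^bsub>V\<^esub> v) \<oplus>\<^bsub>W\<^esub> \<phi> v = \<zero>\<^bsub>W\<^esub>"
    using linear_map_add[OF assms(1), of "\<ominus>\<^bsub>V\<^esub> v" v] linear_map_zero[OF assms(1-3)] assms(4)
    by (simp add: V.l_neg)
  then show ?thesis
    using W.minus_equality[of "\<phi> (\<ominus>\<^bsub>V\<^esub> v)" "\<phi> v"] linear_map_closed[OF assms(1)] assms(4) by simp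
qed

lemma linear_map_comp:
  "linear_map U V \<phi> \<Longrightarrow> linear_map V W \<psi> \<Longrightarrow> linear_map U W (\<lambda>u. \<psi> (\<phi> u))"
  by (auto simp: linear_map_def Pi_iff)

lemma linear_map_inj:
  assumes "linear_map V W \<phi>" "abelian_group V" "abelian_group W"
    and ker: "\<And>v. v \<in> carrier V \<Longrightarrow> \<phi> v = \<zero>\<^bsub>W\<^esub> \<Longrightarrow> v = \<zero>\<^bsub>V\<^esub>"
  shows "inj_on \<phi> (carrier V)"
proof (rule inj_onI)
  interpret V: abelian_group V by fact
  interpret W: abelian_group W by fact
  fix u v assume uv: "u \<in> carrier V" "v \<in> carrier V" "\<phi> u = \<phi> v"
  have "\<phi> (u \<oplus>\<^bsub>V\<^esub> \<ominus>\<^bsub>V\<^esub> v) = \<zero>\<^bsub>W\<^esub>"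
    using uv linear_map_add[OF assms(1)] linear_map_minus[OF assms(1-3)]
      linear_map_closed[OF assms(1)] by (simp add: W.r_neg)
  then have "u \<oplus>\<^bsub>V\<^esub> \<ominus>\<^bsub>V\<^esub> v = \<zero>\<^bsub>V\<^esub>" using uv ker by simp
  then show "u = v" using V.minus_equality[of u "\<ominus>\<^bsub>V\<^esub> v"] uv by simp
qed

lemma linearly_isomorphic_refl: "linearly_isomorphic V V"
  unfolding linearly_isomorphic_def
  by (rule exI[of _ "\<lambda>v. v"]) (auto simp: linear_map_def bij_betw_def)

lemma linearly_isomorphic_trans:
  assumes "linearly_isomorphic U V" "linearly_isomorphic V W"
  shows "linearly_isomorphic U W"
proof -
  obtain \<phi> \<psi> where "linear_map U V \<phi>" "bij_betw \<phi> (carrier U) (carrier V)"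
    "linear_map V W \<psi>" "bij_betw \<psi> (carrier V) (carrier W)"
    using assms unfolding linearly_isomorphic_def by blast
  then have "linear_map U W (\<psi> \<circ> \<phi>) \<and> bij_betw (\<psi> \<circ> \<phi>) (carrier U) (carrier W)"
    using linear_map_comp[of U V \<phi> W \<psi>] bij_betw_trans by (auto simp: comp_def)
  then show ?thesis unfolding linearly_isomorphic_def by blast
qed

lemma linearly_isomorphic_sym:
  assumes "linearly_isomorphic V W" "module (R :: 'r::comm_ring_1 ring) V" "carrier R = UNIV"
  shows "linearly_isomorphic W (V :: ('r, 'm) module)"
proof -
  interpret V: module R V by fact
  obtain \<phi> where lin: "linear_map V W \<phi>" and bij: "bij_betw \<phi> (carrier V) (carrier W)"
    using assms unfolding linearly_isomorphic_def by blast
  define \<psi> where "\<psi> = inv_into (carrier V) \<phi>"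
  have bij': "bij_betw \<psi> (carrier W) (carrier V)"
    unfolding \<psi>_def by (rule bij_betw_inv_into[OF bij])
  have \<phi>\<psi>: "\<phi> (\<psi> w) = w" "\<psi> w \<in> carrier V" if "w \<in> carrier W" for w
    using bij that bij' unfolding \<psi>_def
    by (auto simp: bij_betw_inv_into_right dest: bij_betwE)
  have \<psi>\<phi>: "\<psi> (\<phi> v) = v" if "v \<in> carrier V" for v
    using bij that unfolding \<psi>_def by (simp add: bij_betw_inv_into_left)
  have "linear_map W V \<psi>"
    unfolding linear_map_def
  proof (intro conjI ballI allI)
    show "\<psi> \<in> carrier W \<rightarrow> carrier V" using \<phi>\<psi> by auto
    show "\<psi> (u \<oplus>\<^bsub>W\<^esub> v) = \<psi> u \<oplus>\<^bsub>V\<^esub> \<psi> v" if "u \<in> carrier W" "v \<in> carrier W" for u v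
      using linear_map_add[OF lin, of "\<psi> u" "\<psi> v"] that \<phi>\<psi> \<psi>\<phi>[of "\<psi> u \<oplus>\<^bsub>V\<^esub> \<psi> v"] by simp
    show "\<psi> (c \<odot>\<^bsub>W\<^esub> v) = c \<odot>\<^bsub>V\<^esub> \<psi> v" if "v \<in> carrier W" for c v
      using linear_map_smult[OF lin, of "\<psi> v" c] that \<phi>\<psi> \<psi>\<phi>[of "c \<odot>\<^bsub>V\<^esub> \<psi> v"] assms(3) by simp
  qed
  with bij' show ?thesis unfolding linearly_isomorphic_def by blast
qed

lemma linearly_isomorphic_zero:
  assumes "linearly_isomorphic V W" "abelian_group V" "abelian_group W"
    and "carrier W = {\<zero>\<^bsub>W\<^esub>}"
  shows "carrier V = {\<zero>\<^bsub>V\<^esub>}"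
proof -
  obtain \<phi> where lin: "linear_map V W \<phi>" and bij: "bij_betw \<phi> (carrier V) (carrier W)"
    using assms unfolding linearly_isomorphic_def by blast
  have z: "\<zero>\<^bsub>V\<^esub> \<in> carrier V"
    by (rule abelian_monoid.zero_closed) (simp add: assms abelian_group.axioms)
  have "v = \<zero>\<^bsub>V\<^esub>" if "v \<in> carrier V" for v
    using bij that z assms(4) by (metis bij_betw_apply bij_betw_imp_inj_on inj_onD singletonD)
  with z show ?thesis by blast
qed


section \<open>Linear categories\<close>

context linear_category
begin

lemma hom_abelian: "x \<in> Ob C \<Longrightarrow> y \<in> Ob C \<Longrightarrow> abelian_group (Mor C x y)"
  using hom_module[of x y] module.axioms(2) by auto

lemma zero_mor: "x \<in> Ob C \<Longrightarrow> y \<in> Ob C \<Longrightarrow> \<zero>\<^bsub>Mor C x y\<^esub> \<in> mor C x y"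
  by (rule abelian_monoid.zero_closed) (simp add: hom_abelian abelian_group.axioms)

lemma cmp_zero_right:
  "\<lbrakk>x \<in> Ob C; y \<in> Ob C; z \<in> Ob C; g \<in> mor C y z\<rbrakk> \<Longrightarrow> g \<cdot> \<zero>\<^bsub>Mor C x y\<^esub> = \<zero>\<^bsub>Mor C x z\<^esub>"
  by (rule linear_map_zero[OF cmp_linear_left]) (simp_all add: hom_abelian)

lemma cmp_zero_left:
  "\<lbrakk>x \<in> Ob C; y \<in> Ob C; z \<in> Ob C; f \<in> mor C x y\<rbrakk> \<Longrightarrow> \<zero>\<^bsub>Mor C y z\<^esub> \<cdot> f = \<zero>\<^bsub>Mor C x z\<^esub>"
  by (rule linear_map_zero[OF cmp_linear_right]) (simp_all add: hom_abelian)

lemma cmp_minus_right: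
  "\<lbrakk>x \<in> Ob C; y \<in> Ob C; z \<in> Ob C; f \<in> mor C x y; g \<in> mor C y z\<rbrakk>
    \<Longrightarrow> g \<cdot> (\<ominus>\<^bsub>Mor C x y\<^esub> f) = \<ominus>\<^bsub>Mor C x z\<^esub> (g \<cdot> f)"
  by (rule linear_map_minus[OF cmp_linear_left]) (simp_all add: hom_abelian)

lemma cmp_minus_left:
  "\<lbrakk>x \<in> Ob C; y \<in> Ob C; z \<in> Ob C; f \<in> mor C x y; g \<in> mor C y z\<rbrakk>
    \<Longrightarrow> (\<ominus>\<^bsub>Mor C y z\<^esub> g) \<cdot> f = \<ominus>\<^bsub>Mor C x z\<^esub> (g \<cdot> f)"
  by (rule linear_map_minus[OF cmp_linear_right]) (simp_all add: hom_abelian)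

lemma lin_iso_sym:
  assumes "x \<in> Ob C" "y \<in> Ob C" "linearly_isomorphic (Mor C x y) W"
  shows "linearly_isomorphic W (Mor C x y)"
  using assms(3) hom_module[OF assms(1,2)]
  by (rule linearly_isomorphic_sym) (simp add: ring_of_type_algebra_def)

lemma iso_ob_refl: "x \<in> Ob C \<Longrightarrow> iso_ob C x x"
  unfolding iso_ob_def iso_mor_def using ident_mor ident_left by blast

lemma iso_ob_sym: "iso_ob C x y \<Longrightarrow> iso_ob C y x"
  unfolding iso_ob_def iso_mor_def by blast

lemma iso_ob_trans:
  assumes "iso_ob C x y" "iso_ob C y z"
  shows "iso_ob C x z"
proof -
  have ob: "x \<in> Ob C" "y \<in> Ob C" "z \<in> Ob C" using assms by (auto simp: iso_ob_def)
  obtain f f' g g' where f: "f \<in> mor C x y" "f' \<in> mor C y x" "f' \<cdot> f = ident C x" "f \<cdot> f' = ident C y"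
    and g: "g \<in> mor C y z" "g' \<in> mor C z y" "g' \<cdot> g = ident C y" "g \<cdot> g' = ident C z"
    using assms unfolding iso_ob_def iso_mor_def by blast
  have gf: "g \<cdot> f \<in> mor C x z" "f' \<cdot> g' \<in> mor C z x"
    using f g ob cmp_mor by blast+
  have "(f' \<cdot> g') \<cdot> (g \<cdot> f) = (f' \<cdot> (g' \<cdot> g)) \<cdot> f"
    using cmp_assoc[OF ob ob(1) f(1) g(1) gf(2)] cmp_assoc[OF ob(2,3,2,1) g(1,2) f(2)] by simp
  then have 1: "(f' \<cdot> g') \<cdot> (g \<cdot> f) = ident C x"
    using f g ob ident_right by simp
  have "(g \<cdot> f) \<cdot> (f' \<cdot> g') = (g \<cdot> (f \<cdot> f')) \<cdot> g'"
    using cmp_assoc[OF ob(3,2,1,3) g(2) f(2) gf(1)] cmp_assoc[OF ob(2,1,2,3) f(2,1) g(1)] by simp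
  also have "\<dots> = ident C z" using f g ob ident_right by simp
  finally show ?thesis using 1 gf ob unfolding iso_ob_def iso_mor_def by blast
qed

lemma iso_ob_hom_right:
  assumes "iso_ob C y y'" "x \<in> Ob C"
  shows "linearly_isomorphic (Mor C x y) (Mor C x y')"
proof -
  obtain f g where f: "f \<in> mor C y y'" and g: "g \<in> mor C y' y"
    and inv: "g \<cdot> f = ident C y" "f \<cdot> g = ident C y'" and ob: "y \<in> Ob C" "y' \<in> Ob C"
    using assms unfolding iso_ob_def iso_mor_def by blast
  have "bij_betw (\<lambda>u. f \<cdot> u) (mor C x y) (mor C x y')"
  proof (rule bij_betw_byWitness[where f' = "\<lambda>u. g \<cdot> u"])
    show "\<forall>u\<in>mor C x y. g \<cdot> (f \<cdot> u) = u" "\<forall>u\<in>mor C x y'. f \<cdot> (g \<cdot> u) = u"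
      using cmp_assoc[OF assms(2) ob ob(1) _ f g] cmp_assoc[OF assms(2) ob(2,1,2) _ g f] inv
        ident_left[OF assms(2)] ob by auto
  qed (use cmp_mor f g ob assms(2) in blast)+
  then show ?thesis
    unfolding linearly_isomorphic_def
    using cmp_linear_left[OF assms(2) ob f] by blast
qed

lemma zero_ob_hom: "zero_ob C z \<Longrightarrow> x \<in> Ob C \<Longrightarrow> mor C x z = {\<zero>\<^bsub>Mor C x z\<^esub>}"
  unfolding zero_ob_def using zero_mor by blast

text \<open>
  This turns being a zero object into an equation between morphisms, which every linear functor
  preserves.
\<close>

lemma zero_ob_iff_ident:
  "z \<in> Ob C \<Longrightarrow> zero_ob C z \<longleftrightarrow> ident C z = \<zero>\<^bsub>Mor C z z\<^esub>"
proof
  assume z: "z \<in> Ob C" and *: "ident C z = \<zero>\<^bsub>Mor C z z\<^esub>"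
  have "f = \<zero>\<^bsub>Mor C x z\<^esub>" if "x \<in> Ob C" "f \<in> mor C x z" for x f
    using ident_left[OF that(1) z that(2)] cmp_zero_left[OF that(1) z z that(2)] * by simp
  moreover have "f = \<zero>\<^bsub>Mor C z x\<^esub>" if "x \<in> Ob C" "f \<in> mor C z x" for x f
    using ident_right[OF z that] cmp_zero_right[OF z z that] * by simp
  ultimately show "zero_ob C z"
    unfolding zero_ob_def using z zero_mor by blast
next
  assume z: "z \<in> Ob C" and "zero_ob C z"
  then have "\<exists>!f. f \<in> mor C z z" by (simp add: zero_ob_def)
  then show "ident C z = \<zero>\<^bsub>Mor C z z\<^esub>" using ident_mor[OF z] zero_mor[OF z z] by auto
qed

end

lemma linear_functorD:
  assumes "linear_functor C D Fo Fm"
  shows "x \<in> Ob C \<Longrightarrow> Fo x \<in> Ob D"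
    and "x \<in> Ob C \<Longrightarrow> Fm (ident C x) = ident D (Fo x)"
    and "x \<in> Ob C \<Longrightarrow> y \<in> Ob C \<Longrightarrow> linear_map (Mor C x y) (Mor D (Fo x) (Fo y)) Fm"
    and "\<lbrakk>x \<in> Ob C; y \<in> Ob C; z \<in> Ob C; f \<in> mor C x y; g \<in> mor C y z\<rbrakk>
           \<Longrightarrow> Fm (g \<cdot>\<^bsub>C\<^esub> f) = Fm g \<cdot>\<^bsub>D\<^esub> Fm f"
  using assms by (simp_all add: linear_functor_def)

lemma linear_functor_zero_ob:
  assumes "linear_functor C D Fo Fm" "linear_category C" "linear_category D" "zero_ob C z"
  shows "zero_ob D (Fo z)"
proof -
  interpret C: linear_category C by fact
  interpret D: linear_category D by fact
  have z: "z \<in> Ob C" using assms(4) by (simp add: zero_ob_def)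
  note F = linear_functorD[OF assms(1)]
  have "ident D (Fo z) = \<zero>\<^bsub>Mor D (Fo z) (Fo z)\<^esub>"
    using linear_map_zero[OF F(3)[OF z z] C.hom_abelian[OF z z] D.hom_abelian[OF F(1)[OF z] F(1)[OF z]]]
      C.zero_ob_iff_ident[OF z] F(2)[OF z] assms(4) by simp
  then show ?thesis using D.zero_ob_iff_ident[OF F(1)[OF z]] by simp
qed

lemma linear_functor_iso_mor:
  assumes "linear_functor C D Fo Fm" "x \<in> Ob C" "y \<in> Ob C" "iso_mor C x y f"
  shows "iso_mor D (Fo x) (Fo y) (Fm f)"
proof -
  obtain g where fg: "f \<in> mor C x y" "g \<in> mor C y x" "g \<cdot>\<^bsub>C\<^esub> f = ident C x" "f \<cdot>\<^bsub>C\<^esub> g = ident C y"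
    using assms(4) by (auto simp: iso_mor_def)
  have "Fm f \<in> mor D (Fo x) (Fo y)" "Fm g \<in> mor D (Fo y) (Fo x)"
    using linear_map_closed[OF linear_functorD(3)[OF assms(1)]] assms(2,3) fg by auto
  moreover have "Fm g \<cdot>\<^bsub>D\<^esub> Fm f = ident D (Fo x)" "Fm f \<cdot>\<^bsub>D\<^esub> Fm g = ident D (Fo y)"
    using linear_functorD(2)[OF assms(1)] linear_functorD(4)[OF assms(1), symmetric] assms(2,3) fg by auto
  ultimately show ?thesis unfolding iso_mor_def by blast
qed

lemma linear_functor_iso_ob:
  assumes "linear_functor C D Fo Fm" "iso_ob C x y"
  shows "iso_ob D (Fo x) (Fo y)"
  using assms(2) linear_functor_iso_mor[OF assms(1)] linear_functorD(1)[OF assms(1)]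
  by (auto simp: iso_ob_def)


section \<open>Triangulated categories\<close>

context triangulated_category
begin

lemma sh_Ob: "x \<in> Ob C \<Longrightarrow> sh C x \<in> Ob C"
  using bij_betw_apply[OF sh_bij] by simp

lemma shm_mor: "x \<in> Ob C \<Longrightarrow> y \<in> Ob C \<Longrightarrow> f \<in> mor C x y \<Longrightarrow> shm C f \<in> mor C (sh C x) (sh C y)"
  using bij_betw_apply[OF shm_bij] by simp

lemma shm_inj:
  "x \<in> Ob C \<Longrightarrow> y \<in> Ob C \<Longrightarrow> f \<in> mor C x y \<Longrightarrow> g \<in> mor C x y \<Longrightarrow> shm C f = shm C g \<Longrightarrow> f = g"
  using bij_betw_imp_inj_on[OF shm_bij[of x y]] by (simp add: inj_on_def)

lemma shm_surj:
  "x \<in> Ob C \<Longrightarrow> y \<in> Ob C \<Longrightarrow> g \<in> mor C (sh C x) (sh C y) \<Longrightarrow> \<exists>f\<in>mor C x y. g = shm C f"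
  using bij_betw_imp_surj_on[OF shm_bij[of x y]] by auto

lemma shm_cmp:
  "\<lbrakk>x \<in> Ob C; y \<in> Ob C; z \<in> Ob C; f \<in> mor C x y; g \<in> mor C y z\<rbrakk> \<Longrightarrow> shm C (g \<cdot> f) = shm C g \<cdot> shm C f"
  by (rule linear_functorD(4)[OF sh_functor])

lemma shm_ident: "x \<in> Ob C \<Longrightarrow> shm C (ident C x) = ident C (sh C x)"
  by (rule linear_functorD(2)[OF sh_functor])

lemma sh_inv:
  assumes "x \<in> Ob C"
  shows "inv_into (Ob C) (sh C) x \<in> Ob C" "sh C (inv_into (Ob C) (sh C) x) = x"
  using assms bij_betw_imp_surj_on[OF sh_bij] inv_into_into[of x "sh C" "Ob C"]
    f_inv_into_f[of x "sh C" "Ob C"] by simp_all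

lemma shift_0 [simp]: "shift C x 0 = x"
  by (simp add: shift_def)

lemma shift_Ob: "x \<in> Ob C \<Longrightarrow> shift C x n \<in> Ob C"
proof -
  assume x: "x \<in> Ob C"
  have "(sh C ^^ k) x \<in> Ob C" "(inv_into (Ob C) (sh C) ^^ k) x \<in> Ob C" for k
    by (induction k) (use x sh_Ob sh_inv in auto)
  then show ?thesis unfolding shift_def by simp
qed

lemma shift_succ:
  assumes "x \<in> Ob C"
  shows "shift C x (n + 1) = sh C (shift C x n)"
proof (cases "0 \<le> n")
  case True
  then have "nat (n + 1) = Suc (nat n)" by simp
  with True show ?thesis by (simp add: shift_def)
next
  case False
  then have e: "nat (- n) = Suc (nat (- (n + 1)))" by simp
  have "(inv_into (Ob C) (sh C) ^^ k) x \<in> Ob C" for k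
    by (induction k) (use assms sh_inv in auto)
  with False e show ?thesis by (cases "n = -1") (auto simp: shift_def sh_inv assms)
qed

lemma shift_1: "x \<in> Ob C \<Longrightarrow> shift C x 1 = sh C x"
  using shift_succ[of x 0] by simp

lemma sh_inj: "x \<in> Ob C \<Longrightarrow> y \<in> Ob C \<Longrightarrow> sh C x = sh C y \<Longrightarrow> x = y"
  using bij_betw_imp_inj_on[OF sh_bij] by (simp add: inj_on_def)

lemma shift_shift:
  assumes "x \<in> Ob C"
  shows "shift C (shift C x n) m = shift C x (n + m)"
proof (induction m rule: int_induct[where k = 0])
  case (step1 i)
  then show ?case
    using shift_succ[OF assms, of "n + i"] shift_succ[OF shift_Ob[OF assms], of n i]
    by (simp add: add.assoc)
next
  case (step2 i)
  have "sh C (shift C (shift C x n) (i - 1)) = sh C (shift C x (n + (i - 1)))"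
    using step2 shift_succ[OF assms, of "n + (i - 1)"] shift_succ[OF shift_Ob[OF assms], of n "i - 1"]
    by (simp add: algebra_simps)
  then show ?case
    using sh_inj[OF shift_Ob[OF shift_Ob[OF assms]] shift_Ob[OF assms]] by simp
qed simp

text \<open>
  The shift is fully faithful, so it reflects isomorphism as well as preserving it. The
  reflection provides the downward steps of inductions on the amount of a shift.
\<close>

lemma iso_ob_sh_iff:
  assumes "x \<in> Ob C" "y \<in> Ob C"
  shows "iso_ob C (sh C x) (sh C y) \<longleftrightarrow> iso_ob C x y"
proof
  assume "iso_ob C (sh C x) (sh C y)"
  then obtain f g where fg: "f \<in> mor C (sh C x) (sh C y)" "g \<in> mor C (sh C y) (sh C x)"
    "g \<cdot> f = ident C (sh C x)" "f \<cdot> g = ident C (sh C y)"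
    unfolding iso_ob_def iso_mor_def by blast
  obtain f' g' where fg': "f' \<in> mor C x y" "g' \<in> mor C y x" "f = shm C f'" "g = shm C g'"
    using shm_surj[OF assms fg(1)] shm_surj[OF assms(2,1) fg(2)] by auto
  have "g' \<cdot> f' = ident C x"
    using shm_inj[OF assms(1,1) cmp_mor[OF assms assms(1) fg'(1,2)] ident_mor[OF assms(1)]]
      shm_cmp[OF assms assms(1) fg'(1,2)] shm_ident[OF assms(1)] fg(3) fg'(3,4) by simp
  moreover have "f' \<cdot> g' = ident C y"
    using shm_inj[OF assms(2,2) cmp_mor[OF assms(2,1,2) fg'(2,1)] ident_mor[OF assms(2)]]
      shm_cmp[OF assms(2,1,2) fg'(2,1)] shm_ident[OF assms(2)] fg(4) fg'(3,4) by simp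
  ultimately show "iso_ob C x y"
    using fg'(1,2) assms by (auto simp: iso_ob_def iso_mor_def)
qed (rule linear_functor_iso_ob[OF sh_functor])

lemma iso_ob_shift:
  assumes "iso_ob C x y"
  shows "iso_ob C (shift C x n) (shift C y n)"
proof -
  have ob: "x \<in> Ob C" "y \<in> Ob C" using assms by (auto simp: iso_ob_def)
  show ?thesis
  proof (induction n rule: int_induct[where k = 0])
    case (step1 i)
    then show ?case using ob by (simp add: shift_succ iso_ob_sh_iff shift_Ob)
  next
    case (step2 i)
    then show ?case
      using shift_succ[OF ob(1), of "i - 1"] shift_succ[OF ob(2), of "i - 1"] ob
      by (simp add: iso_ob_sh_iff shift_Ob)
  qed (simp add: assms)
qed

text \<open>
  A map \<open>u\<close> killed by \<open>g\<close> is the first component of a morphism from the rotated trivial triangle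
  \<open>A \<rightarrow> 0 \<rightarrow> A[1]\<close> to the rotated triangle \<open>y \<rightarrow> z \<rightarrow> x[1]\<close>. Its third component \<open>A[1] \<rightarrow> x[1]\<close> is the
  shift of the required lift of \<open>u\<close>; both rotations introduce a sign, and the signs cancel.
\<close>

lemma hom_exact:
  assumes tri: "dtri C x y z f g h" and A: "A \<in> Ob C"
    and u: "u \<in> mor C A y" and gu: "g \<cdot> u = \<zero>\<^bsub>Mor C A z\<^esub>"
  shows "\<exists>v\<in>mor C A x. f \<cdot> v = u"
proof -
  have ob: "x \<in> Ob C" "y \<in> Ob C" "z \<in> Ob C"
    and m: "f \<in> mor C x y" "g \<in> mor C y z" "h \<in> mor C z (sh C x)"
    using dtri_mor[OF tri] by auto
  note so = sh_Ob[OF ob(1)] sh_Ob[OF ob(2)] sh_Ob[OF A]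
  obtain o' where o': "zero_ob C o'" using has_zero_ob by blast
  then have oO: "o' \<in> Ob C" by (simp add: zero_ob_def)
  have t1: "dtri C A o' (sh C A) \<zero>\<^bsub>Mor C A o'\<^esub> \<zero>\<^bsub>Mor C o' (sh C A)\<^esub>
          (\<ominus>\<^bsub>Mor C (sh C A) (sh C A)\<^esub> shm C (ident C A))"
    using TR1_ident[OF A o'] TR2[OF A A oO ident_mor[OF A] zero_mor[OF A oO] zero_mor[OF oO so(3)]]
    by simp
  have t2: "dtri C y z (sh C x) g h (\<ominus>\<^bsub>Mor C (sh C x) (sh C y)\<^esub> shm C f)"
    using TR2[OF ob m] tri by simp
  have t3: "g \<cdot> u = \<zero>\<^bsub>Mor C o' z\<^esub> \<cdot> \<zero>\<^bsub>Mor C A o'\<^esub>"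
    using gu cmp_zero_left[OF A oO ob(3) zero_mor[OF A oO]] by simp
  obtain c where c: "c \<in> mor C (sh C A) (sh C x)"
    and eq: "(\<ominus>\<^bsub>Mor C (sh C x) (sh C y)\<^esub> shm C f) \<cdot> c
              = shm C u \<cdot> (\<ominus>\<^bsub>Mor C (sh C A) (sh C A)\<^esub> shm C (ident C A))"
    using TR3[OF t1 t2 u zero_mor[OF oO ob(3)] t3] by auto
  obtain v where v: "v \<in> mor C A x" "c = shm C v" using shm_surj[OF A ob(1) c] by auto
  have sm: "shm C f \<in> mor C (sh C x) (sh C y)" "shm C u \<in> mor C (sh C A) (sh C y)"
    using shm_mor[OF ob(1,2) m(1)] shm_mor[OF A ob(2) u] .
  have id: "shm C (ident C A) \<in> mor C (sh C A) (sh C A)"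
    using shm_mor[OF A A ident_mor[OF A]] .
  have "\<ominus>\<^bsub>Mor C (sh C A) (sh C y)\<^esub> (shm C f \<cdot> c)
      = \<ominus>\<^bsub>Mor C (sh C A) (sh C y)\<^esub> (shm C u \<cdot> shm C (ident C A))"
    using eq cmp_minus_left[OF so(3,1,2) c sm(1)] cmp_minus_right[OF so(3,3,2) id sm(2)] by simp
  then have "shm C f \<cdot> c = shm C u \<cdot> shm C (ident C A)"
    using abelian_group.minus_minus[OF hom_abelian[OF so(3,2)]]
      cmp_mor[OF so(3,1,2) c sm(1)] cmp_mor[OF so(3,3,2) id sm(2)] by metis
  then have "shm C (f \<cdot> v) = shm C u"
    using v shm_cmp[OF A ob(1,2) v(1) m(1)] shm_ident[OF A] ident_right[OF so(3,2) sm(2)] by simp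
  then show ?thesis
    using shm_inj[OF A ob(2) cmp_mor[OF A ob(1,2) v(1) m(1)] u] v by auto
qed

text \<open>
  In the long exact sequence of maps out of \<open>A\<close>, the kernel of composition with \<open>h\<close> comes from maps
  into \<open>y\<close>, and its cokernel embeds into maps into \<open>y[1]\<close>.
\<close>

lemma hom_connecting_iso:
  assumes tri: "dtri C x y z f g h" and A: "A \<in> Ob C"
    and 0: "mor C A y = {\<zero>\<^bsub>Mor C A y\<^esub>}" "mor C A (sh C y) = {\<zero>\<^bsub>Mor C A (sh C y)\<^esub>}"
  shows "linearly_isomorphic (Mor C A z) (Mor C A (sh C x))"
proof -
  have ob: "x \<in> Ob C" "y \<in> Ob C" "z \<in> Ob C"
    and m: "f \<in> mor C x y" "g \<in> mor C y z" "h \<in> mor C z (sh C x)"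
    using dtri_mor[OF tri] by auto
  note so = sh_Ob[OF ob(1)] sh_Ob[OF ob(2)] sh_Ob[OF ob(3)]
  have tri2: "dtri C y z (sh C x) g h (\<ominus>\<^bsub>Mor C (sh C x) (sh C y)\<^esub> shm C f)"
    using TR2[OF ob m] tri by simp
  then have m3: "\<ominus>\<^bsub>Mor C (sh C x) (sh C y)\<^esub> shm C f \<in> mor C (sh C x) (sh C y)"
    using dtri_mor[of y z "sh C x"] by simp
  have tri3: "dtri C z (sh C x) (sh C y) h (\<ominus>\<^bsub>Mor C (sh C x) (sh C y)\<^esub> shm C f)
                (\<ominus>\<^bsub>Mor C (sh C y) (sh C z)\<^esub> shm C g)"
    using TR2[OF ob(2,3) so(1) m(2,3) m3] tri2 by simp
  have lin: "linear_map (Mor C A z) (Mor C A (sh C x)) (\<lambda>u. h \<cdot> u)"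
    by (rule cmp_linear_left[OF A ob(3) so(1) m(3)])
  have "inj_on (\<lambda>u. h \<cdot> u) (mor C A z)"
  proof (rule linear_map_inj[OF lin hom_abelian[OF A ob(3)] hom_abelian[OF A so(1)]])
    fix u assume "u \<in> mor C A z" "h \<cdot> u = \<zero>\<^bsub>Mor C A (sh C x)\<^esub>"
    then obtain v where "v \<in> mor C A y" "g \<cdot> v = u" using hom_exact[OF tri2 A] by auto
    then show "u = \<zero>\<^bsub>Mor C A z\<^esub>" using 0 cmp_zero_right[OF A ob(2,3) m(2)] by auto
  qed
  moreover have "\<exists>v\<in>mor C A z. h \<cdot> v = w" if w: "w \<in> mor C A (sh C x)" for w
    using hom_exact[OF tri3 A w] cmp_mor[OF A so(1,2) w m3] 0 by simp
  ultimately have "bij_betw (\<lambda>u. h \<cdot> u) (mor C A z) (mor C A (sh C x))"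
    using linear_map_closed[OF lin] by (auto simp: bij_betw_def)
  then show ?thesis unfolding linearly_isomorphic_def using lin by blast
qed

text \<open>
  Most identities hold only up to a shift. Recording the shift as an index of the isomorphism
  relation makes shifts add up under composition and keeps them out of the formulas for objects.
\<close>

definition shift_iso :: "int \<Rightarrow> 'o \<Rightarrow> 'o \<Rightarrow> bool" where
  "shift_iso n x y \<longleftrightarrow> y \<in> Ob C \<and> iso_ob C x (shift C y n)"

lemma shift_iso_Ob: "shift_iso n x y \<Longrightarrow> x \<in> Ob C" "shift_iso n x y \<Longrightarrow> y \<in> Ob C"
  by (auto simp: shift_iso_def iso_ob_def)

lemma shift_iso_0: "shift_iso 0 x y \<longleftrightarrow> iso_ob C x y"
  by (auto simp: shift_iso_def iso_ob_def)

lemma shift_iso_refl: "x \<in> Ob C \<Longrightarrow> shift_iso 0 x x"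
  by (simp add: shift_iso_0 iso_ob_refl)

lemma shift_iso_trans:
  assumes "shift_iso n x y" "shift_iso m y z"
  shows "shift_iso (n + m) x z"
proof -
  have z: "z \<in> Ob C" by (rule shift_iso_Ob(2)[OF assms(2)])
  have "iso_ob C (shift C y n) (shift C (shift C z m) n)"
    using assms(2) iso_ob_shift[of y _ n] by (simp add: shift_iso_def)
  then show ?thesis
    using assms(1) iso_ob_trans[of x "shift C y n"] z shift_shift[OF z, of m n]
    by (simp add: shift_iso_def add.commute)
qed

lemma shift_iso_sym:
  assumes "shift_iso n x y"
  shows "shift_iso (- n) y x"
proof -
  note ob = shift_iso_Ob[OF assms]
  have "iso_ob C (shift C x (- n)) (shift C (shift C y n) (- n))"
    using assms iso_ob_shift[of x _ "- n"] by (simp add: shift_iso_def)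
  then show ?thesis
    using ob iso_ob_sym[of "shift C x (- n)"] by (simp add: shift_iso_def shift_shift)
qed

text \<open>
  All shifts are included so that orthogonality is insensitive to the shifts which accumulate when
  the target is rewritten.
\<close>

definition orthogonal :: "'o \<Rightarrow> 'o \<Rightarrow> bool" where
  "orthogonal x y \<longleftrightarrow> (\<forall>n. mor C x (shift C y n) = {\<zero>\<^bsub>Mor C x (shift C y n)\<^esub>})"

lemma orthogonal_shift_iso:
  assumes "shift_iso m y z" "x \<in> Ob C" "orthogonal x z"
  shows "orthogonal x y"
  unfolding orthogonal_def
proof
  fix n
  note y = shift_iso_Ob(1)[OF assms(1)] and z = shift_iso_Ob(2)[OF assms(1)]
  have "iso_ob C (shift C y n) (shift C z (m + n))"
    using iso_ob_shift[of y "shift C z m" n] assms(1) z by (simp add: shift_iso_def shift_shift)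
  then have "linearly_isomorphic (Mor C x (shift C y n)) (Mor C x (shift C z (m + n)))"
    using iso_ob_hom_right assms(2) by simp
  then show "mor C x (shift C y n) = {\<zero>\<^bsub>Mor C x (shift C y n)\<^esub>}"
    by (rule linearly_isomorphic_zero)
      (use hom_abelian shift_Ob y z assms(2,3) in \<open>simp_all add: orthogonal_def\<close>)
qed

lemma sh_zero_ob: "zero_ob C z \<Longrightarrow> zero_ob C (sh C z)"
  by (rule linear_functor_zero_ob[OF sh_functor linear_category_axioms linear_category_axioms])

text \<open>
  Zero objects are closed under the shift, because it is a linear functor, and any two of them are
  isomorphic; hence all shifts of \<open>z\<close>, also the negative ones, are isomorphic to \<open>z\<close>.
\<close>

lemma orthogonal_zero_ob:
  assumes "zero_ob C z" "x \<in> Ob C"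
  shows "orthogonal x z"
  unfolding orthogonal_def
proof
  fix n
  have z: "z \<in> Ob C" using assms by (simp add: zero_ob_def)
  have "iso_ob C z (sh C z)"
  proof -
    have s: "zero_ob C (sh C z)" "sh C z \<in> Ob C" using sh_zero_ob assms z sh_Ob by auto
    have "ident C z = \<zero>\<^bsub>Mor C z z\<^esub>" "ident C (sh C z) = \<zero>\<^bsub>Mor C (sh C z) (sh C z)\<^esub>"
      using zero_ob_iff_ident z s assms(1) by auto
    then show ?thesis
      using z s zero_mor[OF z s(2)] zero_mor[OF s(2) z] cmp_zero_right[OF z s(2) z zero_mor[OF s(2) z]]
        cmp_zero_right[OF s(2) z s(2) zero_mor[OF z s(2)]]
      by (auto simp: iso_ob_def iso_mor_def intro!: exI[of _ "\<zero>\<^bsub>Mor C z (sh C z)\<^esub>"] bexI[of _ "\<zero>\<^bsub>Mor C (sh C z) z\<^esub>"])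
  qed
  then have step: "iso_ob C (shift C z i) (shift C z (i + 1))" for i
    using iso_ob_shift[OF \<open>iso_ob C z (sh C z)\<close>, of i] z shift_1[OF z] shift_shift[OF z, of 1 i]
    by (simp add: add.commute)
  have "iso_ob C z (shift C z n)"
  proof (induction n rule: int_induct[where k = 0])
    case base then show ?case using iso_ob_refl z by simp
  next
    case (step1 i) then show ?case using iso_ob_trans[OF _ step[of i]] by simp
  next
    case (step2 i) then show ?case using iso_ob_trans[OF _ iso_ob_sym[OF step[of "i - 1"]]] by simp
  qed
  then have "linearly_isomorphic (Mor C x (shift C z n)) (Mor C x z)"
    using iso_ob_hom_right iso_ob_sym assms(2) by simp
  then show "mor C x (shift C z n) = {\<zero>\<^bsub>Mor C x (shift C z n)\<^esub>}"
    by (rule linearly_isomorphic_zero)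
      (use hom_abelian shift_Ob z assms zero_ob_hom[OF assms] in simp_all)
qed

end

lemma exact_functor_shift:
  assumes ex: "exact_functor C D Fo Fm" and tri: "triangulated_category C" "triangulated_category D"
    and x: "x \<in> Ob C"
  shows "iso_ob D (Fo (shift C x n)) (shift D (Fo x) n)"
proof -
  interpret C: triangulated_category C by fact
  interpret D: triangulated_category D by fact
  have FO: "\<And>y. y \<in> Ob C \<Longrightarrow> Fo y \<in> Ob D"
    using ex linear_functorD(1)[of C D Fo Fm] by (simp add: exact_functor_def)
  obtain \<phi> where "\<forall>y\<in>Ob C. iso_mor D (Fo (sh C y)) (sh D (Fo y)) (\<phi> y)"
    using ex by (auto simp: exact_functor_def)
  then have sh: "iso_ob D (Fo (sh C y)) (sh D (Fo y))" if "y \<in> Ob C" for y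
    using that FO C.sh_Ob D.sh_Ob by (auto simp: iso_ob_def)
  show ?thesis
  proof (induction n rule: int_induct[where k = 0])
    case base
    then show ?case using x FO D.iso_ob_refl by simp
  next
    case (step1 i)
    have "iso_ob D (sh D (Fo (shift C x i))) (sh D (shift D (Fo x) i))"
      using step1 x FO C.shift_Ob D.shift_Ob D.iso_ob_sh_iff by simp
    then show ?case
      using D.iso_ob_trans[OF sh[OF C.shift_Ob[OF x, of i]]] x FO
      by (simp add: C.shift_succ D.shift_succ)
  next
    case (step2 i)
    have "iso_ob D (sh D (Fo (shift C x (i - 1)))) (Fo (shift C x i))"
      using sh[OF C.shift_Ob[OF x, of "i - 1"]] C.shift_succ[OF x, of "i - 1"] D.iso_ob_sym by simp
    then have "iso_ob D (sh D (Fo (shift C x (i - 1)))) (sh D (shift D (Fo x) (i - 1)))"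
      using D.iso_ob_trans[OF _ step2(2)] D.shift_succ[OF FO[OF x], of "i - 1"] by simp
    then show ?case using x FO C.shift_Ob D.shift_Ob D.iso_ob_sh_iff by simp
  qed
qed

lemma exact_functor_shift_iso:
  assumes ex: "exact_functor C D Fo Fm" and tri: "triangulated_category C" "triangulated_category D"
    and xy: "triangulated_category.shift_iso C n x y"
  shows "triangulated_category.shift_iso D n (Fo x) (Fo y)"
proof -
  interpret C: triangulated_category C by fact
  interpret D: triangulated_category D by fact
  have lin: "linear_functor C D Fo Fm" using ex by (simp add: exact_functor_def)
  have y: "y \<in> Ob C" by (rule C.shift_iso_Ob(2)[OF xy])
  have "iso_ob D (Fo x) (Fo (shift C y n))"
    using linear_functor_iso_ob[OF lin] xy by (simp add: C.shift_iso_def)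
  then show ?thesis
    using D.iso_ob_trans[OF _ exact_functor_shift[OF ex tri y]] linear_functorD(1)[OF lin y]
    by (simp add: D.shift_iso_def)
qed


section \<open>Triangulated 2-categories\<close>

context triangulated_2category
begin

text \<open>
  The operations of a 2-category do not know the source and target of their arguments. The predicates
  \<open>arr\<close> and \<open>cell\<close> collect these typing conditions for 1-morphisms and for 2-morphisms.
\<close>

definition arr :: "'o \<Rightarrow> 'o \<Rightarrow> 'f \<Rightarrow> bool" where
  "arr a b f \<longleftrightarrow> a \<in> Ob2 K \<and> b \<in> Ob2 K \<and> f \<in> Ob (HomCat K a b)"

definition cell :: "'o \<Rightarrow> 'o \<Rightarrow> 'f \<Rightarrow> 'f \<Rightarrow> 'm \<Rightarrow> bool" where
  "cell a b f g s \<longleftrightarrow> arr a b f \<and> arr a b g \<and> s \<in> mor (HomCat K a b) f g"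

text \<open>
  \<open>sim a b n f g\<close> stands for \<open>f \<cong> g[n]\<close>. Exactness of composition makes this relation a congruence with
  additive index, so that equations up to shift can be handled as in a graded monoid.
\<close>

definition sim :: "'o \<Rightarrow> 'o \<Rightarrow> int \<Rightarrow> 'f \<Rightarrow> 'f \<Rightarrow> bool" where
  "sim a b n f g \<longleftrightarrow> a \<in> Ob2 K \<and> b \<in> Ob2 K \<and> triangulated_category.shift_iso (HomCat K a b) n f g"

lemma hom_triangulated: "arr a b f \<Longrightarrow> triangulated_category (HomCat K a b)"
  by (simp add: arr_def HomCat_triangulated)

lemma hom_linear: "arr a b f \<Longrightarrow> linear_category (HomCat K a b)"
  using hom_triangulated[of a b f] triangulated_category.axioms(1) additive_category.axioms(1) by auto

lemma arr_one: "a \<in> Ob2 K \<Longrightarrow> arr a a (one1 K a)"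
  by (simp add: arr_def one1_Ob)

lemma arr_cmp: "arr a b f \<Longrightarrow> arr b c g \<Longrightarrow> arr a c (g \<diamondop> f)"
  using cmp1_Ob[of a b c f g] by (simp add: arr_def)

lemma assoc: "arr a b f \<Longrightarrow> arr b c g \<Longrightarrow> arr c d h \<Longrightarrow> h \<diamondop> (g \<diamondop> f) = (h \<diamondop> g) \<diamondop> f"
  using cmp1_assoc[of a b c d f g h] by (simp add: arr_def)

lemma one_right: "arr a b f \<Longrightarrow> f \<diamondop> one1 K a = f"
  using cmp1_one_right[of a b f] by (simp add: arr_def)

lemma one_left: "arr a b f \<Longrightarrow> one1 K b \<diamondop> f = f"
  using cmp1_one_left[of a b f] by (simp add: arr_def)

lemma sim_refl: "arr a b f \<Longrightarrow> sim a b 0 f f"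
  using triangulated_category.shift_iso_refl[OF HomCat_triangulated, of a b f] by (simp add: sim_def arr_def)

lemma sim_trans: "sim a b n f g \<Longrightarrow> sim a b m g h \<Longrightarrow> n + m = l \<Longrightarrow> sim a b l f h"
  using triangulated_category.shift_iso_trans[OF HomCat_triangulated, of a b n f g m h]
  by (simp add: sim_def)

lemma sim_trans0: "sim a b n f g \<Longrightarrow> sim a b m g h \<Longrightarrow> sim a b (n + m) f h"
  by (rule sim_trans) auto

lemma sim_sym: "sim a b n f g \<Longrightarrow> n + m = 0 \<Longrightarrow> sim a b m g f"
  using triangulated_category.shift_iso_sym[OF HomCat_triangulated, of a b n f g]
  by (simp add: sim_def add_eq_0_iff)

lemma sim_left: "sim a b n f f' \<Longrightarrow> arr b c g \<Longrightarrow> sim a c n (g \<diamondop> f) (g \<diamondop> f')"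
  using exact_functor_shift_iso[OF cmp1_exact_left HomCat_triangulated HomCat_triangulated, of a b c g n f f']
  by (simp add: sim_def arr_def)

lemma sim_right: "sim b c n g g' \<Longrightarrow> arr a b f \<Longrightarrow> sim a c n (g \<diamondop> f) (g' \<diamondop> f)"
  using exact_functor_shift_iso[OF cmp1_exact_right HomCat_triangulated HomCat_triangulated, of a b c f n g g']
  by (simp add: sim_def arr_def)

lemma sim_iso: "a \<in> Ob2 K \<Longrightarrow> b \<in> Ob2 K \<Longrightarrow> iso_ob (HomCat K a b) f g \<Longrightarrow> sim a b 0 f g"
  using triangulated_category.shift_iso_0[OF HomCat_triangulated] by (simp add: sim_def)

lemma sim_iso_shift:
  "\<lbrakk>a \<in> Ob2 K; b \<in> Ob2 K; g \<in> Ob (HomCat K a b); iso_ob (HomCat K a b) f (shift (HomCat K a b) g n)\<rbrakk>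
    \<Longrightarrow> sim a b n f g"
  using triangulated_category.shift_iso_def[OF HomCat_triangulated] by (simp add: sim_def)

text \<open>
  Composition is additive in each variable; this is what kills every 1-morphism passing through a
  weight outside the range.
\<close>

lemma zero_cmp_right:
  assumes "zero_ob (HomCat K a b) f" "arr a b f" "arr b c g"
  shows "zero_ob (HomCat K a c) (g \<diamondop> f)"
  using assms cmp1_exact_left[of a b c g] hom_linear[OF assms(2)] hom_linear[OF arr_cmp[OF assms(2,3)]]
  by (intro linear_functor_zero_ob[where Fo = "\<lambda>f. g \<diamondop> f"]) (auto simp: arr_def exact_functor_def)

lemma zero_cmp_left:
  assumes "zero_ob (HomCat K b c) g" "arr a b f" "arr b c g"
  shows "zero_ob (HomCat K a c) (g \<diamondop> f)"
  using assms cmp1_exact_right[of a b c f] hom_linear[OF assms(3)] hom_linear[OF arr_cmp[OF assms(2,3)]]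
  by (intro linear_functor_zero_ob[where Fo = "\<lambda>g. g \<diamondop> f"]) (auto simp: arr_def exact_functor_def)

text \<open>
  Integer powers are iterates of \<open>f\<close> or of \<open>f'\<close>, depending on the sign of the exponent. When \<open>f'\<close> is
  inverse to \<open>f\<close>, composing with \<open>f\<close> raises the exponent and composing with \<open>f'\<close> lowers it, across the
  change of sign as well; the exponent law follows by induction in both directions.
\<close>

lemma power1_arr:
  assumes "arr a a f" "arr a a f'"
  shows "arr a a (power1 K a f f' n)"
proof -
  have "arr a a (((\<lambda>g. h \<diamondop> g) ^^ k) (one1 K a))" if "arr a a h" for h k
    by (induction k) (use that arr_cmp arr_one in \<open>auto simp: arr_def\<close>)
  then show ?thesis using assms by (simp add: power1_def)
qed

lemma power1_succ:
  assumes f: "arr a a f" "arr a a f'" and inv: "sim a a 0 (f \<diamondop> f') (one1 K a)"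
  shows "sim a a 0 (f \<diamondop> power1 K a f f' n) (power1 K a f f' (n + 1))"
proof (cases "0 \<le> n")
  case True
  then have "f \<diamondop> power1 K a f f' n = power1 K a f f' (n + 1)"
    by (simp add: power1_def nat_add_distrib)
  then show ?thesis using sim_refl[OF power1_arr[OF f]] by metis
next
  case False
  then have e: "nat (- n) = Suc (nat (- (n + 1)))" by simp
  have "power1 K a f f' n = f' \<diamondop> power1 K a f f' (n + 1)"
    using False e by (cases "n = -1") (auto simp: power1_def)
  then have "f \<diamondop> power1 K a f f' n = (f \<diamondop> f') \<diamondop> power1 K a f f' (n + 1)"
    using assoc[OF power1_arr[OF f] f(2,1)] by simp
  then show ?thesis
    using sim_right[OF inv power1_arr[OF f]] one_left[OF power1_arr[OF f]] by metis
qed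

lemma power1_pred:
  assumes f: "arr a a f" "arr a a f'"
    and inv: "sim a a 0 (f \<diamondop> f') (one1 K a)" "sim a a 0 (f' \<diamondop> f) (one1 K a)"
  shows "sim a a 0 (f' \<diamondop> power1 K a f f' n) (power1 K a f f' (n - 1))"
proof -
  let ?P = "power1 K a f f'"
  note P = power1_arr[OF f]
  have "sim a a 0 (f \<diamondop> ?P (n - 1)) (?P n)"
    using power1_succ[OF f inv(1), of "n - 1"] by simp
  from sim_left[OF sim_sym[OF this, of 0] f(2)]
  have "sim a a 0 (f' \<diamondop> ?P n) ((f' \<diamondop> f) \<diamondop> ?P (n - 1))"
    using assoc[OF P f] by simp
  moreover have "sim a a 0 ((f' \<diamondop> f) \<diamondop> ?P (n - 1)) (?P (n - 1))"
    using sim_right[OF inv(2) P, of "n - 1"] one_left[OF P] by simp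
  ultimately show ?thesis by (rule sim_trans) simp
qed

lemma power1_add:
  assumes f: "arr a a f" "arr a a f'"
    and inv: "sim a a 0 (f \<diamondop> f') (one1 K a)" "sim a a 0 (f' \<diamondop> f) (one1 K a)"
  shows "sim a a 0 (power1 K a f f' n \<diamondop> power1 K a f f' m) (power1 K a f f' (n + m))"
proof -
  let ?P = "power1 K a f f'"
  note P = power1_arr[OF f]
  have step: "sim a a 0 (?P i' \<diamondop> ?P m) (?P (i' + m))"
    if IH: "sim a a 0 (?P i \<diamondop> ?P m) (?P (i + m))"
      and g: "arr a a g" "\<And>j. sim a a 0 (g \<diamondop> ?P j) (?P (j + (i' - i)))" for i i' g
  proof -
    have "sim a a 0 (?P i') (g \<diamondop> ?P i)" using sim_sym[OF g(2)[of i], of 0] by simp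
    from sim_right[OF this P] have "sim a a 0 (?P i' \<diamondop> ?P m) (g \<diamondop> (?P i \<diamondop> ?P m))"
      using assoc[OF P P g(1)] by simp
    moreover have "sim a a 0 (g \<diamondop> (?P i \<diamondop> ?P m)) (g \<diamondop> ?P (i + m))"
      by (rule sim_left[OF IH g(1)])
    ultimately have "sim a a 0 (?P i' \<diamondop> ?P m) (g \<diamondop> ?P (i + m))" by (rule sim_trans) simp
    from sim_trans[OF this g(2)[of "i + m"]] show ?thesis by (simp add: algebra_simps)
  qed
  show ?thesis
  proof (induction n rule: int_induct[where k = 0])
    case base
    then show ?case using one_left[OF P] sim_refl[OF P] by (simp add: power1_def[of _ _ _ _ 0])
  next
    case (step1 i)
    show ?case by (rule step[OF step1(2) f(1)]) (use power1_succ[OF f inv(1)] in simp)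
  next
    case (step2 i)
    show ?case by (rule step[OF step2(2) f(2)]) (use power1_pred[OF f inv] in simp)
  qed
qed

lemma cell_h:
  "cell a b f f' s \<Longrightarrow> cell b c g g' t \<Longrightarrow> cell a c (g \<diamondop> f) (g' \<diamondop> f') (t \<star> s)"
  using hcmp_mor[of a b c f f' g g' s t] cmp1_Ob[of a b c f g] cmp1_Ob[of a b c f' g']
  by (simp add: cell_def arr_def)

lemma cell_v:
  "cell a b f g s \<Longrightarrow> cell a b g h t \<Longrightarrow> cell a b f h (t \<cdot>\<^bsub>HomCat K a b\<^esub> s)"
  using linear_category.cmp_mor[OF hom_linear[of a b f]] by (auto simp: cell_def arr_def)

lemma cell_ident: "arr a b f \<Longrightarrow> cell a b f f (ident2 K a b f)"
  using linear_category.ident_mor[OF hom_linear[of a b f]] by (simp add: cell_def arr_def)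

lemma cell_assoc:
  "cell a b f g s \<Longrightarrow> cell a b g h t \<Longrightarrow> cell a b h k u
    \<Longrightarrow> u \<cdot>\<^bsub>HomCat K a b\<^esub> (t \<cdot>\<^bsub>HomCat K a b\<^esub> s) = (u \<cdot>\<^bsub>HomCat K a b\<^esub> t) \<cdot>\<^bsub>HomCat K a b\<^esub> s"
  using linear_category.cmp_assoc[OF hom_linear[of a b f], of f g h k s t u] by (auto simp: cell_def arr_def)

lemma cell_ident_right: "cell a b f g s \<Longrightarrow> s \<cdot>\<^bsub>HomCat K a b\<^esub> ident2 K a b f = s"
  using linear_category.ident_right[OF hom_linear[of a b f]] by (auto simp: cell_def arr_def)

lemma cell_ident_left: "cell a b f g s \<Longrightarrow> ident2 K a b g \<cdot>\<^bsub>HomCat K a b\<^esub> s = s"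
  using linear_category.ident_left[OF hom_linear[of a b f]] by (auto simp: cell_def arr_def)

lemma cell_h_assoc:
  "cell a b f f' s \<Longrightarrow> cell b c g g' t \<Longrightarrow> cell c d h h' u \<Longrightarrow> u \<star> (t \<star> s) = (u \<star> t) \<star> s"
  using hcmp_assoc[of a b c d f f' g g' h h' s t u] by (simp add: cell_def arr_def)

lemma cell_h_ident: "arr a b f \<Longrightarrow> arr b c g \<Longrightarrow> ident2 K b c g \<star> ident2 K a b f = ident2 K a c (g \<diamondop> f)"
  using hcmp_ident[of a b c f g] by (simp add: arr_def)

lemma cell_one_left: "cell a b f f' s \<Longrightarrow> ident2 K b b (one1 K b) \<star> s = s"
  using hcmp_one_left[of a b f f' s] by (simp add: cell_def arr_def)

lemma cell_interchange:
  "\<lbrakk>cell a b f f' s; cell a b f' f'' s'; cell b c g g' t; cell b c g' g'' t'\<rbrakk>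
    \<Longrightarrow> (t' \<cdot>\<^bsub>HomCat K b c\<^esub> t) \<star> (s' \<cdot>\<^bsub>HomCat K a b\<^esub> s) = (t' \<star> s') \<cdot>\<^bsub>HomCat K a c\<^esub> (t \<star> s)"
  using interchange[of a b c f f' f'' g g' g'' s s' t t'] by (simp add: cell_def arr_def)

text \<open>
  Two 2-cells on adjacent 1-morphisms may be applied in either order; this slides the unit or counit
  past a 2-cell in the proof that transposition is invertible.
\<close>

lemma cell_slide_left:
  assumes s: "cell a b f f' s" and t: "cell b c g g' t"
  shows "(t \<star> ident2 K a b f') \<cdot>\<^bsub>HomCat K a c\<^esub> (ident2 K b c g \<star> s) = t \<star> s"
proof -
  have "arr a b f'" "arr b c g" using s t by (auto simp: cell_def)
  then show ?thesis
    using cell_interchange[OF s cell_ident cell_ident t] cell_ident_left[OF s] cell_ident_right[OF t] by simp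
qed

lemma cell_slide_right:
  assumes s: "cell a b f f' s" and t: "cell b c g g' t"
  shows "(ident2 K b c g' \<star> s) \<cdot>\<^bsub>HomCat K a c\<^esub> (t \<star> ident2 K a b f) = t \<star> s"
proof -
  have "arr a b f" "arr b c g'" using s t by (auto simp: cell_def)
  then show ?thesis
    using cell_interchange[OF cell_ident s t cell_ident] cell_ident_right[OF s] cell_ident_left[OF t] by simp
qed

lemma whisker_left_cmp:
  assumes "cell a b f f' s" "cell a b f' f'' s'" "arr b c g"
  shows "ident2 K b c g \<star> (s' \<cdot>\<^bsub>HomCat K a b\<^esub> s)
    = (ident2 K b c g \<star> s') \<cdot>\<^bsub>HomCat K a c\<^esub> (ident2 K b c g \<star> s)"
  using cell_interchange[OF assms(1,2) cell_ident[OF assms(3)] cell_ident[OF assms(3)]]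
    cell_ident_left[OF cell_ident[OF assms(3)]] by simp

lemma whisker_right_cmp:
  assumes "cell b c g g' t" "cell b c g' g'' t'" "arr a b f"
  shows "(t' \<cdot>\<^bsub>HomCat K b c\<^esub> t) \<star> ident2 K a b f
    = (t' \<star> ident2 K a b f) \<cdot>\<^bsub>HomCat K a c\<^esub> (t \<star> ident2 K a b f)"
  using cell_interchange[OF cell_ident[OF assms(3)] cell_ident[OF assms(3)] assms(1,2)]
    cell_ident_left[OF cell_ident[OF assms(3)]] by simp

text \<open>
  Composition with adjoint 1-morphisms is adjoint on Hom-categories: transposition is whiskering
  followed by composition with the unit, and the zig-zag identities make it invertible.
\<close>

lemma adjunction_hom_iso:
  assumes adj: "right_adjoint K a b f g" and x: "arr c a x" and w: "arr c b w"
  shows "linearly_isomorphic (Mor (HomCat K c b) (f \<diamondop> x) w) (Mor (HomCat K c a) x (g \<diamondop> w))"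
proof -
  have abc: "a \<in> Ob2 K" "b \<in> Ob2 K" "c \<in> Ob2 K" using x w by (auto simp: arr_def)
  have f: "arr a b f" and g: "arr b a g"
    using adj abc by (auto simp: right_adjoint_def arr_def)
  obtain \<eta> \<epsilon> where \<eta>m: "\<eta> \<in> mor (HomCat K a a) (one1 K a) (g \<diamondop> f)"
    and \<epsilon>m: "\<epsilon> \<in> mor (HomCat K b b) (f \<diamondop> g) (one1 K b)"
    and zigzag_f: "(\<epsilon> \<star> ident2 K a b f) \<cdot>\<^bsub>HomCat K a b\<^esub> (ident2 K a b f \<star> \<eta>) = ident2 K a b f"
    and zigzag_g: "(ident2 K b a g \<star> \<epsilon>) \<cdot>\<^bsub>HomCat K b a\<^esub> (\<eta> \<star> ident2 K b a g) = ident2 K b a g"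
    using adj unfolding right_adjoint_def by blast
  have \<eta>: "cell a a (one1 K a) (g \<diamondop> f) \<eta>" and \<epsilon>: "cell b b (f \<diamondop> g) (one1 K b) \<epsilon>"
    using \<eta>m \<epsilon>m arr_cmp[OF f g] arr_cmp[OF g f] arr_one abc by (auto simp: cell_def)
  note fx = arr_cmp[OF x f] and gw = arr_cmp[OF w g]
  note i = cell_ident
  define \<phi> where "\<phi> t = (ident2 K b a g \<star> t) \<cdot>\<^bsub>HomCat K c a\<^esub> (\<eta> \<star> ident2 K c a x)" for t
  define \<psi> where "\<psi> u = (\<epsilon> \<star> ident2 K c b w) \<cdot>\<^bsub>HomCat K c b\<^esub> (ident2 K a b f \<star> u)" for u
  have \<eta>x: "cell c a x (g \<diamondop> (f \<diamondop> x)) (\<eta> \<star> ident2 K c a x)"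
    using cell_h[OF i[OF x] \<eta>] one_left[OF x] assoc[OF x f g] by simp
  have \<epsilon>w: "cell c b (f \<diamondop> (g \<diamondop> w)) w (\<epsilon> \<star> ident2 K c b w)"
    using cell_h[OF i[OF w] \<epsilon>] one_left[OF w] assoc[OF w g f] by simp
  have \<phi>: "cell c a x (g \<diamondop> w) (\<phi> t)" if t: "cell c b (f \<diamondop> x) w t" for t
    unfolding \<phi>_def by (rule cell_v[OF \<eta>x cell_h[OF t i[OF g]]])
  have \<psi>: "cell c b (f \<diamondop> x) w (\<psi> u)" if u: "cell c a x (g \<diamondop> w) u" for u
    unfolding \<psi>_def by (rule cell_v[OF cell_h[OF u i[OF f]] \<epsilon>w])
  have \<phi>\<psi>: "\<phi> (\<psi> u) = u" if u: "cell c a x (g \<diamondop> w) u" for u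
  proof -
    note fu = cell_h[OF u i[OF f]]
    have "\<phi> (\<psi> u) = ((ident2 K b a g \<star> (\<epsilon> \<star> ident2 K c b w)) \<cdot>\<^bsub>HomCat K c a\<^esub>
        (ident2 K b a g \<star> (ident2 K a b f \<star> u))) \<cdot>\<^bsub>HomCat K c a\<^esub> (\<eta> \<star> ident2 K c a x)"
      unfolding \<phi>_def \<psi>_def by (simp add: whisker_left_cmp[OF fu \<epsilon>w g])
    also have "\<dots> = (ident2 K b a g \<star> (\<epsilon> \<star> ident2 K c b w)) \<cdot>\<^bsub>HomCat K c a\<^esub>
        ((ident2 K b a g \<star> (ident2 K a b f \<star> u)) \<cdot>\<^bsub>HomCat K c a\<^esub> (\<eta> \<star> ident2 K c a x))"
      by (rule cell_assoc[symmetric, OF \<eta>x cell_h[OF fu i[OF g]] cell_h[OF \<epsilon>w i[OF g]]])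
    also have "(ident2 K b a g \<star> (ident2 K a b f \<star> u)) \<cdot>\<^bsub>HomCat K c a\<^esub> (\<eta> \<star> ident2 K c a x)
        = (\<eta> \<star> ident2 K c a (g \<diamondop> w)) \<cdot>\<^bsub>HomCat K c a\<^esub> u"
      using cell_h_assoc[OF u i[OF f] i[OF g]] cell_h_ident[OF f g] cell_slide_right[OF u \<eta>]
        cell_slide_left[OF u \<eta>] cell_one_left[OF u] by simp
    also have "(ident2 K b a g \<star> (\<epsilon> \<star> ident2 K c b w)) \<cdot>\<^bsub>HomCat K c a\<^esub>
        ((\<eta> \<star> ident2 K c a (g \<diamondop> w)) \<cdot>\<^bsub>HomCat K c a\<^esub> u)
      = ((ident2 K b a g \<star> (\<epsilon> \<star> ident2 K c b w)) \<cdot>\<^bsub>HomCat K c a\<^esub>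
        (\<eta> \<star> ident2 K c a (g \<diamondop> w))) \<cdot>\<^bsub>HomCat K c a\<^esub> u"
    proof (rule cell_assoc[OF _ _ cell_h[OF \<epsilon>w i[OF g]]])
      show "cell c a x (g \<diamondop> w) u" by (rule u)
      show "cell c a (g \<diamondop> w) (g \<diamondop> (f \<diamondop> (g \<diamondop> w))) (\<eta> \<star> ident2 K c a (g \<diamondop> w))"
        using cell_h[OF i[OF gw] \<eta>] one_left[OF gw] assoc[OF gw f g] by simp
    qed
    also have "(ident2 K b a g \<star> (\<epsilon> \<star> ident2 K c b w)) \<cdot>\<^bsub>HomCat K c a\<^esub>
        (\<eta> \<star> ident2 K c a (g \<diamondop> w))
      = ((ident2 K b a g \<star> \<epsilon>) \<star> ident2 K c b w) \<cdot>\<^bsub>HomCat K c a\<^esub>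
        ((\<eta> \<star> ident2 K b a g) \<star> ident2 K c b w)"
      using cell_h_assoc[OF i[OF w] \<epsilon> i[OF g]] cell_h_ident[OF w g]
        cell_h_assoc[OF i[OF w] i[OF g] \<eta>] by simp
    also have "\<dots> = ident2 K c a (g \<diamondop> w)"
    proof -
      have zig: "cell b a g (g \<diamondop> (f \<diamondop> g)) (\<eta> \<star> ident2 K b a g)"
        using cell_h[OF i[OF g] \<eta>] one_left[OF g] assoc[OF g f g] by simp
      then show ?thesis
        using whisker_right_cmp[OF zig cell_h[OF \<epsilon> i[OF g]] w] zigzag_g cell_h_ident[OF w g] by simp
    qed
    finally show ?thesis using cell_ident_left[OF u] by simp
  qed
  have \<psi>\<phi>: "\<psi> (\<phi> t) = t" if t: "cell c b (f \<diamondop> x) w t" for t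
  proof -
    note gt = cell_h[OF t i[OF g]]
    have f\<eta>x: "cell c b (f \<diamondop> x) (f \<diamondop> (g \<diamondop> (f \<diamondop> x))) (ident2 K a b f \<star> (\<eta> \<star> ident2 K c a x))"
      by (rule cell_h[OF \<eta>x i[OF f]])
    have "\<psi> (\<phi> t) = (\<epsilon> \<star> ident2 K c b w) \<cdot>\<^bsub>HomCat K c b\<^esub> ((ident2 K a b f \<star> (ident2 K b a g \<star> t))
        \<cdot>\<^bsub>HomCat K c b\<^esub> (ident2 K a b f \<star> (\<eta> \<star> ident2 K c a x)))"
      unfolding \<phi>_def \<psi>_def by (simp add: whisker_left_cmp[OF \<eta>x gt f])
    also have "\<dots> = ((\<epsilon> \<star> ident2 K c b w) \<cdot>\<^bsub>HomCat K c b\<^esub> (ident2 K a b f \<star> (ident2 K b a g \<star> t)))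
        \<cdot>\<^bsub>HomCat K c b\<^esub> (ident2 K a b f \<star> (\<eta> \<star> ident2 K c a x))"
      by (rule cell_assoc[OF f\<eta>x cell_h[OF gt i[OF f]] \<epsilon>w])
    also have "(\<epsilon> \<star> ident2 K c b w) \<cdot>\<^bsub>HomCat K c b\<^esub> (ident2 K a b f \<star> (ident2 K b a g \<star> t))
        = t \<cdot>\<^bsub>HomCat K c b\<^esub> (\<epsilon> \<star> ident2 K c b (f \<diamondop> x))"
      using cell_h_assoc[OF t i[OF g] i[OF f]] cell_h_ident[OF g f] cell_slide_right[OF t \<epsilon>]
        cell_slide_left[OF t \<epsilon>] cell_one_left[OF t] by simp
    also have "(t \<cdot>\<^bsub>HomCat K c b\<^esub> (\<epsilon> \<star> ident2 K c b (f \<diamondop> x)))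
        \<cdot>\<^bsub>HomCat K c b\<^esub> (ident2 K a b f \<star> (\<eta> \<star> ident2 K c a x))
      = t \<cdot>\<^bsub>HomCat K c b\<^esub> ((\<epsilon> \<star> ident2 K c b (f \<diamondop> x))
        \<cdot>\<^bsub>HomCat K c b\<^esub> (ident2 K a b f \<star> (\<eta> \<star> ident2 K c a x)))"
    proof (rule cell_assoc[symmetric, OF f\<eta>x _ t])
      show "cell c b (f \<diamondop> (g \<diamondop> (f \<diamondop> x))) (f \<diamondop> x) (\<epsilon> \<star> ident2 K c b (f \<diamondop> x))"
        using cell_h[OF i[OF fx] \<epsilon>] one_left[OF fx] assoc[OF fx g f] by simp
    qed
    also have "(\<epsilon> \<star> ident2 K c b (f \<diamondop> x)) \<cdot>\<^bsub>HomCat K c b\<^esub> (ident2 K a b f \<star> (\<eta> \<star> ident2 K c a x))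
      = ((\<epsilon> \<star> ident2 K a b f) \<star> ident2 K c a x) \<cdot>\<^bsub>HomCat K c b\<^esub>
        ((ident2 K a b f \<star> \<eta>) \<star> ident2 K c a x)"
      using cell_h_assoc[OF i[OF x] \<eta> i[OF f]] cell_h_ident[OF x f]
        cell_h_assoc[OF i[OF x] i[OF f] \<epsilon>] by simp
    also have "\<dots> = ident2 K c b (f \<diamondop> x)"
    proof -
      have zig: "cell a b f ((f \<diamondop> g) \<diamondop> f) (ident2 K a b f \<star> \<eta>)"
        using cell_h[OF \<eta> i[OF f]] one_right[OF f] assoc[OF f g f] by simp
      then show ?thesis
        using whisker_right_cmp[OF zig cell_h[OF i[OF f] \<epsilon>] x] zigzag_f cell_h_ident[OF x f] by simp
    qed
    finally show ?thesis using cell_ident_right[OF t] by simp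
  qed
  have cellI: "cell c b (f \<diamondop> x) w t \<longleftrightarrow> t \<in> mor (HomCat K c b) (f \<diamondop> x) w"
    "cell c a x (g \<diamondop> w) u \<longleftrightarrow> u \<in> mor (HomCat K c a) x (g \<diamondop> w)" for t u
    using fx w x gw by (auto simp: cell_def)
  have "bij_betw \<phi> (mor (HomCat K c b) (f \<diamondop> x) w) (mor (HomCat K c a) x (g \<diamondop> w))"
    by (rule bij_betw_byWitness[where f' = \<psi>]) (use \<phi> \<psi> \<phi>\<psi> \<psi>\<phi> cellI in auto)
  moreover have "linear_map (Mor (HomCat K c b) (f \<diamondop> x) w) (Mor (HomCat K c a) x (g \<diamondop> w)) \<phi>"
    unfolding \<phi>_def
  proof (rule linear_map_comp[where V = "Mor (HomCat K c a) (g \<diamondop> (f \<diamondop> x)) (g \<diamondop> w)"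
        and \<phi> = "\<lambda>s. ident2 K b a g \<star> s"
        and \<psi> = "\<lambda>s. s \<cdot>\<^bsub>HomCat K c a\<^esub> (\<eta> \<star> ident2 K c a x)"])
    have "linear_functor (HomCat K c b) (HomCat K c a) (\<lambda>f. g \<diamondop> f) (\<lambda>s. ident2 K b a g \<star> s)"
      using cmp1_exact_left[of c b a g] g abc by (simp add: exact_functor_def arr_def)
    from linear_functorD(3)[OF this, of "f \<diamondop> x" w]
    show "linear_map (Mor (HomCat K c b) (f \<diamondop> x) w) (Mor (HomCat K c a) (g \<diamondop> (f \<diamondop> x)) (g \<diamondop> w))
       (\<lambda>s. ident2 K b a g \<star> s)"
      using fx w by (simp add: arr_def)
    show "linear_map (Mor (HomCat K c a) (g \<diamondop> (f \<diamondop> x)) (g \<diamondop> w)) (Mor (HomCat K c a) x (g \<diamondop> w))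
       (\<lambda>s. s \<cdot>\<^bsub>HomCat K c a\<^esub> (\<eta> \<star> ident2 K c a x))"
      using linear_category.cmp_linear_right[OF hom_linear[OF x], of x "g \<diamondop> (f \<diamondop> x)" "g \<diamondop> w"]
        \<eta>x gw by (simp add: cell_def arr_def)
  qed
  ultimately show ?thesis unfolding linearly_isomorphic_def by blast
qed

definition orth :: "'o \<Rightarrow> 'o \<Rightarrow> 'f \<Rightarrow> 'f \<Rightarrow> bool" where
  "orth a b x y \<longleftrightarrow> triangulated_category.orthogonal (HomCat K a b) x y"

lemma orth_sim: "sim a b n y z \<Longrightarrow> arr a b x \<Longrightarrow> orth a b x z \<Longrightarrow> orth a b x y"
  using triangulated_category.orthogonal_shift_iso[OF HomCat_triangulated, of a b n y z x]
  by (simp add: sim_def arr_def orth_def)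

lemma orth_zero: "zero_ob (HomCat K a b) z \<Longrightarrow> arr a b x \<Longrightarrow> orth a b x z"
  using triangulated_category.orthogonal_zero_ob[OF HomCat_triangulated, of a b z x]
  by (simp add: arr_def orth_def)

text \<open>
  Transposition is applied to every shift of \<open>w\<close>; it leads to the same shift of \<open>g \<diamondop> w\<close>, since
  composition with \<open>g\<close> commutes with the shift up to isomorphism.
\<close>

lemma adjunction_orth:
  assumes adj: "right_adjoint K a b f g" and x: "arr c a x" and w: "arr c b w"
    and orth: "orth c a x (g \<diamondop> w)"
  shows "orth c b (f \<diamondop> x) w"
proof -
  interpret ca: triangulated_category "HomCat K c a" by (rule hom_triangulated[OF x])
  interpret cb: triangulated_category "HomCat K c b" by (rule hom_triangulated[OF w])
  have f: "arr a b f" and g: "arr b a g"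
    using adj x w by (auto simp: right_adjoint_def arr_def)
  have ob: "x \<in> Ob (HomCat K c a)" "w \<in> Ob (HomCat K c b)" "f \<diamondop> x \<in> Ob (HomCat K c b)"
    using x w arr_cmp[OF x f] by (auto simp: arr_def)
  have "mor (HomCat K c b) (f \<diamondop> x) (shift (HomCat K c b) w n)
      = {\<zero>\<^bsub>Mor (HomCat K c b) (f \<diamondop> x) (shift (HomCat K c b) w n)\<^esub>}" for n
  proof -
    let ?wn = "shift (HomCat K c b) w n"
    have wn: "arr c b ?wn" using w cb.shift_Ob by (simp add: arr_def)
    have gwn: "g \<diamondop> ?wn \<in> Ob (HomCat K c a)" using arr_cmp[OF wn g] by (simp add: arr_def)
    have "sim c b n ?wn w"
      using w cb.iso_ob_refl cb.shift_Ob by (intro sim_iso_shift) (auto simp: arr_def)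
    from orth_sim[OF sim_left[OF this g] x orth]
    have "mor (HomCat K c a) x (g \<diamondop> ?wn) = {\<zero>\<^bsub>Mor (HomCat K c a) x (g \<diamondop> ?wn)\<^esub>}"
      unfolding orth_def ca.orthogonal_def using ca.shift_0 by metis
    then show ?thesis
      by (rule linearly_isomorphic_zero[OF adjunction_hom_iso[OF adj x wn], rotated 2])
        (use ca.hom_abelian[OF ob(1) gwn] cb.hom_abelian[OF ob(3)] cb.shift_Ob[OF ob(2)] in auto)
  qed
  then show ?thesis by (simp add: orth_def cb.orthogonal_def)
qed

lemma hom_sim:
  assumes "sim a b n y z" "arr a b x"
  shows "linearly_isomorphic (Mor (HomCat K a b) x y) (Mor (HomCat K a b) x (shift (HomCat K a b) z n))"
proof -
  interpret triangulated_category "HomCat K a b" by (rule hom_triangulated[OF assms(2)])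
  show ?thesis
    using assms by (intro iso_ob_hom_right) (auto simp: sim_def shift_iso_def arr_def)
qed

lemma dtri_cmp_left:
  assumes "\<exists>u v w. dtri (HomCat K a b) x y z u v w" "arr b c g" "a \<in> Ob2 K"
  shows "\<exists>u v w. dtri (HomCat K a c) (g \<diamondop> x) (g \<diamondop> y) (g \<diamondop> z) u v w"
proof -
  have "exact_functor (HomCat K a b) (HomCat K a c) (\<lambda>f. g \<diamondop> f) (\<lambda>s. ident2 K b c g \<star> s)"
    using cmp1_exact_left[of a b c g] assms by (simp add: arr_def)
  then show ?thesis using assms(1) unfolding exact_functor_def by blast
qed

lemma dtri_cmp_right:
  assumes "\<exists>u v w. dtri (HomCat K b c) x y z u v w" "arr a b f" "c \<in> Ob2 K"
  shows "\<exists>u v w. dtri (HomCat K a c) (x \<diamondop> f) (y \<diamondop> f) (z \<diamondop> f) u v w"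
proof -
  have "exact_functor (HomCat K b c) (HomCat K a c) (\<lambda>g. g \<diamondop> f) (\<lambda>t. t \<star> ident2 K a b f)"
    using cmp1_exact_right[of a b c f] assms by (simp add: arr_def)
  then show ?thesis using assms(1) unfolding exact_functor_def by blast
qed

text \<open>
  Orthogonality to the middle term covers its shift too, and the long exact sequence needs both to
  vanish.
\<close>

lemma hom_connecting_orth:
  assumes tri: "\<exists>u v w. dtri (HomCat K a b) y1 y2 y3 u v w" and x: "arr a b x" and orth: "orth a b x y2"
  shows "linearly_isomorphic (Mor (HomCat K a b) x y3) (Mor (HomCat K a b) x (shift (HomCat K a b) y1 1))"
proof -
  interpret triangulated_category "HomCat K a b" by (rule hom_triangulated[OF x])
  obtain u v w where t: "dtri (HomCat K a b) y1 y2 y3 u v w" using tri by blast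
  have y: "y1 \<in> Ob (HomCat K a b)" "y2 \<in> Ob (HomCat K a b)" using dtri_mor[OF t] by auto
  have "mor (HomCat K a b) x (shift (HomCat K a b) y2 n)
      = {\<zero>\<^bsub>Mor (HomCat K a b) x (shift (HomCat K a b) y2 n)\<^esub>}" for n
    using orth by (simp add: orth_def orthogonal_def)
  from this[of 0] this[of 1] show ?thesis
    using hom_connecting_iso[OF t] x y by (simp add: shift_1 arr_def)
qed

end


section \<open>Commuting E with its right adjoint in a partial action\<close>

lemma lex_less_Cons:
  "lex_less (x # \<mu>) (y # \<mu>') \<longleftrightarrow> x < y \<or> x = y \<and> lex_less \<mu> \<mu>'" (is "?l \<longleftrightarrow> ?r")
proof
  assume ?l
  then obtain j where j: "j < length (x # \<mu>)" "j < length (y # \<mu>')"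
    "\<forall>i<j. (x # \<mu>) ! i = (y # \<mu>') ! i" "(x # \<mu>) ! j < (y # \<mu>') ! j"
    unfolding lex_less_def by blast
  show ?r
  proof (cases j)
    case (Suc l)
    have "x = y" using j(3) Suc by force
    moreover have "\<mu> ! i = \<mu>' ! i" if "i < l" for i using j(3) Suc that by force
    ultimately show ?thesis using j Suc unfolding lex_less_def by auto
  qed (use j in auto)
next
  assume ?r
  then show ?l
  proof
    assume "x < y"
    then show ?l unfolding lex_less_def by (intro exI[of _ 0]) simp
  next
    assume "x = y \<and> lex_less \<mu> \<mu>'"
    then obtain j where "x = y" "j < length \<mu>" "j < length \<mu>'" "\<forall>i<j. \<mu> ! i = \<mu>' ! i" "\<mu> ! j < \<mu>' ! j"
      unfolding lex_less_def by blast
    then show ?l unfolding lex_less_def by (intro exI[of _ "Suc j"]) (auto simp: less_Suc_eq_0_disj)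
  qed
qed

context partial_sl2_action
begin

text \<open>In this parametrisation \<open>E\<close> raises the index by one and \<open>F\<close> lowers it.\<close>

abbreviation wt :: "int \<Rightarrow> int \<times> int" where
  "wt i \<equiv> (int N - i, i)"

abbreviation \<W> where
  "\<W> i \<equiv> wcat K (wt i)"

abbreviation E where
  "E r i \<equiv> Efun K r (wt i)"

abbreviation F where
  "F s i \<equiv> Ffun K s (wt i)"

abbreviation P where
  "P n i \<equiv> PsiP_pow K (wt i) n"

lemma wt_line: "wt i \<in> weight_line N"
  by (simp add: weight_line_def)

lemma wt_weight: "0 \<le> i \<Longrightarrow> i \<le> int N \<Longrightarrow> wt i \<in> weights N"
  by (simp add: weights_def)

lemma W_Ob: "\<W> i \<in> Ob2 K"
  using objects wt_line by auto

lemma arr_E: "i - int N - 1 \<le> r \<Longrightarrow> r \<le> 0 \<Longrightarrow> arr (\<W> i) (\<W> (i + 1)) (E r i)"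
  using Efun_Ob[OF wt_line, of i r] W_Ob[of i] W_Ob[of "i + 1"] by (simp add: arr_def diff_diff_eq)

lemma arr_F: "0 \<le> s \<Longrightarrow> s \<le> i + 1 \<Longrightarrow> arr (\<W> i) (\<W> (i - 1)) (F s i)"
  using Ffun_Ob[OF wt_line, of s i] W_Ob[of i] W_Ob[of "i - 1"] by (simp add: arr_def diff_diff_eq2 diff_add_eq)

lemma arr_Psi: "arr (\<W> i) (\<W> i) (PsiP K (wt i))" "arr (\<W> i) (\<W> i) (PsiP' K (wt i))"
  using Psi_Ob[OF wt_line, of i] W_Ob[of i] by (auto simp: arr_def)

lemma arr_P: "arr (\<W> i) (\<W> i) (P n i)"
  by (rule power1_arr[OF arr_Psi])

lemma Psi_inv:
  assumes "0 \<le> i" "i \<le> int N"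
  shows "sim (\<W> i) (\<W> i) 0 (PsiP K (wt i) \<diamondop> PsiP' K (wt i)) (one1 K (\<W> i))"
    and "sim (\<W> i) (\<W> i) 0 (PsiP' K (wt i) \<diamondop> PsiP K (wt i)) (one1 K (\<W> i))"
  using PsiP_inverse[OF wt_weight[OF assms]] W_Ob[of i] by (auto intro: sim_iso)

lemma P_add:
  "0 \<le> i \<Longrightarrow> i \<le> int N \<Longrightarrow> n + m = l \<Longrightarrow> sim (\<W> i) (\<W> i) 0 (P n i \<diamondop> P m i) (P l i)"
  using power1_add[OF arr_Psi Psi_inv, of i n m] by simp

lemma P_0: "P 0 i = one1 K (\<W> i)"
  by (simp add: power1_def)

lemma P_1: "P 1 i = PsiP K (wt i)"
  using one_right[OF arr_Psi(1)[of i]] by (simp add: power1_def)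

lemma P_cancel:
  assumes i: "0 \<le> i" "i \<le> int N" and x: "arr c (\<W> i) x" and nm: "n + m = 0"
  shows "sim c (\<W> i) 0 (P n i \<diamondop> (P m i \<diamondop> x)) x"
  using sim_right[OF P_add[OF i nm] x] assoc[OF x arr_P arr_P] one_left[OF x] by (simp add: P_0)

lemma outside_one_zero: "i < 0 \<Longrightarrow> zero_ob (HomCat K (\<W> i) (\<W> i)) (one1 K (\<W> i))"
  using outside_zero[of "wt i"] wt_line[of i] by (simp add: weights_def)

lemma P_E_step:
  assumes "0 \<le> i" "i \<le> int N" "i - int N - 1 \<le> r" "r + 1 \<le> 0"
  shows "sim (\<W> i) (\<W> (i + 1)) (-1) (P 1 (i + 1) \<diamondop> E r i) (E (r + 1) i \<diamondop> P 1 i)"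
proof -
  have "arr (\<W> i) (\<W> (i + 1)) (E (r + 1) i \<diamondop> P 1 i)"
    by (rule arr_cmp[OF arr_P arr_E]) (use assms in auto)
  then show ?thesis
    using Psi_E[OF wt_weight[OF assms(1,2)], of r] assms W_Ob[of i] W_Ob[of "i + 1"]
    by (intro sim_iso_shift) (auto simp: P_1 diff_diff_eq arr_def)
qed

lemma P_E_pos:
  assumes i: "0 \<le> i" "i < int N" and r: "i - int N - 1 \<le> r" "r + int n \<le> 0"
  shows "sim (\<W> i) (\<W> (i + 1)) (- int n) (P (int n) (i + 1) \<diamondop> E r i) (E (r + int n) i \<diamondop> P (int n) i)"
  using r(2)
proof (induction n)
  case 0
  have "arr (\<W> i) (\<W> (i + 1)) (E r i)" by (rule arr_E) (use r in auto)
  then show ?case using one_left one_right sim_refl by (simp add: P_0)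
next
  case (Suc n)
  define q where "q = r + int n"
  have Er: "arr (\<W> i) (\<W> (i + 1)) (E r i)" and Eq: "arr (\<W> i) (\<W> (i + 1)) (E q i)"
    and Eq1: "arr (\<W> i) (\<W> (i + 1)) (E (q + 1) i)"
    by (rule arr_E; use r Suc.prems q_def in simp)+
  have i': "0 \<le> i" "i \<le> int N" "0 \<le> i + 1" "i + 1 \<le> int N" using i by auto
  have IH: "sim (\<W> i) (\<W> (i + 1)) (- int n) (P (int n) (i + 1) \<diamondop> E r i) (E q i \<diamondop> P (int n) i)"
    using Suc by (simp add: q_def)
  have a: "1 + int n = int (Suc n)" "q + 1 = r + int (Suc n)" by (auto simp: q_def)
  have "sim (\<W> i) (\<W> (i + 1)) 0 (P (int (Suc n)) (i + 1) \<diamondop> E r i) (P 1 (i + 1) \<diamondop> (P (int n) (i + 1) \<diamondop> E r i))"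
    using sim_right[OF sim_sym[OF P_add[OF i'(3,4) a(1)], of 0] Er] assoc[OF Er arr_P arr_P] by simp
  from sim_trans[OF this sim_left[OF IH arr_P]]
  have "sim (\<W> i) (\<W> (i + 1)) (- int n) (P (int (Suc n)) (i + 1) \<diamondop> E r i)
          ((P 1 (i + 1) \<diamondop> E q i) \<diamondop> P (int n) i)"
    using assoc[OF arr_P Eq arr_P] by simp
  moreover have "sim (\<W> i) (\<W> (i + 1)) (-1) ((P 1 (i + 1) \<diamondop> E q i) \<diamondop> P (int n) i)
      (E (q + 1) i \<diamondop> (P 1 i \<diamondop> P (int n) i))"
    using sim_right[OF P_E_step[OF i'(1,2)] arr_P] assoc[OF arr_P arr_P Eq1] r Suc.prems q_def by simp
  ultimately have "sim (\<W> i) (\<W> (i + 1)) (- int (Suc n)) (P (int (Suc n)) (i + 1) \<diamondop> E r i)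
      (E (q + 1) i \<diamondop> (P 1 i \<diamondop> P (int n) i))"
    by (rule sim_trans) simp
  from sim_trans[OF this sim_left[OF P_add[OF i'(1,2) a(1)] Eq1]]
  show ?case by (simp only: a add_0_right)
qed

text \<open>
  For negative powers the positive case is applied to the target index and conjugated by \<open>\<Psi>\<^sup>+\<close>, so only indices between \<open>r\<close> and \<open>r + n\<close> occur.
\<close>

lemma P_E:
  assumes i: "0 \<le> i" "i < int N" and r: "i - int N - 1 \<le> r" "r \<le> 0" "i - int N - 1 \<le> r + n" "r + n \<le> 0"
  shows "sim (\<W> i) (\<W> (i + 1)) (- n) (P n (i + 1) \<diamondop> E r i) (E (r + n) i \<diamondop> P n i)"
proof (cases "0 \<le> n")
  case True
  then show ?thesis using P_E_pos[OF i r(1), of "nat n"] r by simp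
next
  case False
  define m where "m = nat (- n)"
  have m: "n = - int m" using False by (simp add: m_def)
  define q where "q = r + n"
  have E: "arr (\<W> i) (\<W> (i + 1)) (E r i)" "arr (\<W> i) (\<W> (i + 1)) (E q i)"
    by (rule arr_E; use r q_def in simp)+
  have i': "0 \<le> i" "i \<le> int N" "0 \<le> i + 1" "i + 1 \<le> int N" using i by auto
  have pos: "sim (\<W> i) (\<W> (i + 1)) n (P (- n) (i + 1) \<diamondop> E q i) (E r i \<diamondop> P (- n) i)"
    using P_E_pos[OF i, of q m] r m by (simp add: q_def)
  have EP: "arr (\<W> i) (\<W> (i + 1)) (E q i \<diamondop> P n i)" by (rule arr_cmp[OF arr_P E(2)])
  have s1: "sim (\<W> i) (\<W> (i + 1)) 0 (E q i \<diamondop> P n i) (P n (i + 1) \<diamondop> (P (- n) (i + 1) \<diamondop> (E q i \<diamondop> P n i)))"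
    by (rule sim_sym[OF P_cancel[OF i'(3,4) EP]]) auto
  have s2: "sim (\<W> i) (\<W> (i + 1)) n (P n (i + 1) \<diamondop> (P (- n) (i + 1) \<diamondop> (E q i \<diamondop> P n i)))
      (P n (i + 1) \<diamondop> (E r i \<diamondop> (P (- n) i \<diamondop> P n i)))"
    using sim_left[OF sim_right[OF pos arr_P] arr_P] assoc[OF arr_P E(2) arr_P] assoc[OF arr_P arr_P E(1)]
    by simp
  have s3: "sim (\<W> i) (\<W> (i + 1)) 0 (P n (i + 1) \<diamondop> (E r i \<diamondop> (P (- n) i \<diamondop> P n i))) (P n (i + 1) \<diamondop> E r i)"
    using sim_left[OF sim_left[OF P_add[OF i'(1,2), of "- n" n 0] E(1)] arr_P] one_right[OF E(1)]
    by (simp add: P_0)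
  have "sim (\<W> i) (\<W> (i + 1)) n (E q i \<diamondop> P n i) (P n (i + 1) \<diamondop> E r i)"
    using sim_trans0[OF sim_trans0[OF s1 s2] s3] by simp
  then show ?thesis unfolding q_def by (rule sim_sym) simp
qed

text \<open>
  The axioms express the adjoint through \<open>F (i + 2)\<close>. Since the commutation relations at weight \<open>wt i\<close>
  involve \<open>F s\<close> on both sides, they require \<open>s \<le> i + 1\<close>. One power of \<open>\<Psi>\<^sup>+\<close> is therefore moved through
  \<open>F (i + 2)\<close>, which lowers its index to the largest admissible one and contributes one to the shift.
\<close>

lemma E_adjoint:
  assumes i: "0 \<le> i" "i < int N" and m: "0 \<le> m" "m \<le> int N - i + 1"
  shows "\<exists>G. right_adjoint K (\<W> i) (\<W> (i + 1)) (E (- m) i) G \<and>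
    sim (\<W> (i + 1)) (\<W> i) m G (P (- m) i \<diamondop> (F (i + 1) (i + 1) \<diamondop> P (m - 1) (i + 1)))"
proof -
  let ?a = "\<W> i" and ?b = "\<W> (i + 1)"
  have i': "0 \<le> i" "i \<le> int N" "0 \<le> i + 1" "i + 1 \<le> int N" using i by auto
  have F2: "arr ?b ?a (F (i + 2) (i + 1))" and F1: "arr ?b ?a (F (i + 1) (i + 1))"
    using arr_F[of "i + 2" "i + 1"] arr_F[of "i + 1" "i + 1"] i by simp_all
  have FP: "arr ?b ?a (F (i + 1) (i + 1) \<diamondop> P n (i + 1))" for n
    by (rule arr_cmp[OF arr_P F1])
  have "arr ?b ?a (P (1 - m) i \<diamondop> (F (i + 2) (i + 1) \<diamondop> P (m - 2) (i + 1)))"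
    by (rule arr_cmp[OF arr_cmp[OF arr_P F2] arr_P])
  then obtain G where adj: "right_adjoint K ?a ?b (E (- m) i) G"
    and G: "sim ?b ?a (m - 1) G (P (1 - m) i \<diamondop> (F (i + 2) (i + 1) \<diamondop> P (m - 2) (i + 1)))"
    using E_right_adjoint[OF wt_weight[OF i'(1,2)], of "- m"] m W_Ob[of i] W_Ob[of "i + 1"]
    by (auto simp: diff_diff_eq arr_def intro!: sim_iso_shift)
  have "sim ?b ?a 1 (P 1 i \<diamondop> F (i + 2) (i + 1)) (F (i + 1) (i + 1) \<diamondop> P 1 (i + 1))"
    using Psi_F[OF wt_weight[OF i'(3,4)], of "i + 2"] FP[of 1] i W_Ob[of i] W_Ob[of "i + 1"]
    by (intro sim_iso_shift) (auto simp: P_1 arr_def add.commute)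
  from sim_trans[OF sim_sym[OF P_cancel[OF i'(1,2) F2, of "-1" 1], of 0] sim_left[OF this arr_P, of "-1"]]
  have "sim ?b ?a 1 (F (i + 2) (i + 1)) (P (-1) i \<diamondop> (F (i + 1) (i + 1) \<diamondop> P 1 (i + 1)))"
    by simp
  from sim_left[OF sim_right[OF this arr_P, of "m - 2"] arr_P, of "1 - m"]
  have s1: "sim ?b ?a 1 (P (1 - m) i \<diamondop> (F (i + 2) (i + 1) \<diamondop> P (m - 2) (i + 1)))
      ((P (1 - m) i \<diamondop> P (-1) i) \<diamondop> (F (i + 1) (i + 1) \<diamondop> (P 1 (i + 1) \<diamondop> P (m - 2) (i + 1))))"
    using assoc[OF arr_P FP arr_P, symmetric] assoc[OF arr_P arr_P F1]
      assoc[OF arr_cmp[OF arr_P FP] arr_P arr_P] by simp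
  have s2: "sim ?b ?a 0
      ((P (1 - m) i \<diamondop> P (-1) i) \<diamondop> (F (i + 1) (i + 1) \<diamondop> (P 1 (i + 1) \<diamondop> P (m - 2) (i + 1))))
      (P (- m) i \<diamondop> (F (i + 1) (i + 1) \<diamondop> (P 1 (i + 1) \<diamondop> P (m - 2) (i + 1))))"
    by (rule sim_right[OF P_add[OF i'(1,2)] arr_cmp[OF arr_cmp[OF arr_P arr_P] F1]]) simp
  have s3: "sim ?b ?a 0
      (P (- m) i \<diamondop> (F (i + 1) (i + 1) \<diamondop> (P 1 (i + 1) \<diamondop> P (m - 2) (i + 1))))
      (P (- m) i \<diamondop> (F (i + 1) (i + 1) \<diamondop> P (m - 1) (i + 1)))"
    by (rule sim_left[OF sim_left[OF P_add[OF i'(3,4)] F1] arr_P]) simp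
  have "sim ?b ?a 1 (P (1 - m) i \<diamondop> (F (i + 2) (i + 1) \<diamondop> P (m - 2) (i + 1)))
      (P (- m) i \<diamondop> (F (i + 1) (i + 1) \<diamondop> P (m - 1) (i + 1)))"
    using sim_trans0[OF sim_trans0[OF s1 s2] s3] by simp
  from sim_trans[OF G this, of m] adj show ?thesis by auto
qed

text \<open>
  The power \<open>m - 1\<close> of \<open>\<Psi>\<^sup>+\<close> slides through \<open>E r i\<close>, and the shifts \<open>m\<close> and \<open>- (m - 1)\<close> combine to \<open>1\<close>. The
  indices of the resulting \<open>F\<close> and \<open>E\<close> add up to \<open>i + r + m\<close>: they commute if \<open>- N < r + m < 0\<close>, and they
  are related by the exact triangle with third term \<open>\<Psi>\<^sup>+\<close> if \<open>r = - m\<close>.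
\<close>

lemma E_adjoint_E:
  assumes i: "0 \<le> i" "i < int N" and m: "0 \<le> m" "m \<le> int N - i + 1"
    and r: "r \<le> 0" "i - int N - 1 \<le> r" "r + m - 1 \<le> 0" "i - int N - 1 \<le> r + m - 1"
    and y: "arr c (\<W> i) y"
  shows "\<exists>G. right_adjoint K (\<W> i) (\<W> (i + 1)) (E (- m) i) G \<and>
    sim c (\<W> i) 1 (G \<diamondop> (E r i \<diamondop> y))
      (P (- m) i \<diamondop> ((F (i + 1) (i + 1) \<diamondop> E (r + m - 1) i) \<diamondop> (P (m - 1) i \<diamondop> y)))"
proof -
  let ?a = "\<W> i" and ?b = "\<W> (i + 1)" and ?q = "r + m - 1"
  have Er: "arr ?a ?b (E r i)" and Eq: "arr ?a ?b (E ?q i)"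
    by (rule arr_E; use r in simp)+
  have F1: "arr ?b ?a (F (i + 1) (i + 1))" using arr_F[of "i + 1" "i + 1"] i by simp
  have Ery: "arr c ?b (E r i \<diamondop> y)" by (rule arr_cmp[OF y Er])
  obtain G where adj: "right_adjoint K ?a ?b (E (- m) i) G"
    and G: "sim ?b ?a m G (P (- m) i \<diamondop> (F (i + 1) (i + 1) \<diamondop> P (m - 1) (i + 1)))"
    using E_adjoint[OF i m] by blast
  from sim_right[OF G Ery]
  have "sim c ?a m (G \<diamondop> (E r i \<diamondop> y))
      (P (- m) i \<diamondop> (F (i + 1) (i + 1) \<diamondop> ((P (m - 1) (i + 1) \<diamondop> E r i) \<diamondop> y)))"
    using assoc[OF Ery arr_cmp[OF arr_P F1] arr_P] assoc[OF Ery arr_P F1] assoc[OF y Er arr_P] by simp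
  moreover have "sim ?a ?b (- (m - 1)) (P (m - 1) (i + 1) \<diamondop> E r i) (E ?q i \<diamondop> P (m - 1) i)"
    using P_E[OF i, of r "m - 1"] r by (simp add: add_diff_eq)
  from sim_left[OF sim_left[OF sim_right[OF this y] F1] arr_P]
  have "sim c ?a (- (m - 1))
      (P (- m) i \<diamondop> (F (i + 1) (i + 1) \<diamondop> ((P (m - 1) (i + 1) \<diamondop> E r i) \<diamondop> y)))
      (P (- m) i \<diamondop> ((F (i + 1) (i + 1) \<diamondop> E ?q i) \<diamondop> (P (m - 1) i \<diamondop> y)))"
    using assoc[OF y arr_P Eq] assoc[OF arr_cmp[OF y arr_P] Eq F1] by simp
  ultimately have "sim c ?a 1 (G \<diamondop> (E r i \<diamondop> y))
      (P (- m) i \<diamondop> ((F (i + 1) (i + 1) \<diamondop> E ?q i) \<diamondop> (P (m - 1) i \<diamondop> y)))"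
    by (rule sim_trans) simp
  with adj show ?thesis by blast
qed


end


section \<open>Morphisms between composites of the E\<close>

context partial_sl2_action
begin

lemma E_minus_arr:
  "\<forall>x\<in>set \<nu>. 0 \<le> x \<and> x \<le> int N - int (length \<nu>) \<Longrightarrow> arr (\<W> 0) (\<W> (int (length \<nu>))) (E_minus K N \<nu>)"
proof (induction \<nu>)
  case Nil
  then show ?case using arr_one[OF W_Ob[of 0]] by simp
next
  case (Cons x \<nu>)
  have "arr (\<W> 0) (\<W> (int (length \<nu>))) (E_minus K N \<nu>)"
    by (rule Cons.IH) (use Cons.prems in force)
  moreover have "arr (\<W> (int (length \<nu>))) (\<W> (int (length \<nu>) + 1)) (E (- x) (int (length \<nu>)))"
    by (rule arr_E) (use Cons.prems in auto)
  ultimately show ?case using arr_cmp by (simp add: add.commute)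
qed

text \<open>
  Up to shift, the target is \<open>E (- (a + c))\<close> applied to some 1-morphism, by \<open>P_E\<close>. Let \<open>m = a + c\<close>, let
  \<open>x < m\<close> be the first entry of \<open>\<nu>\<close> and \<open>j\<close> the number of the remaining ones. By adjunction the entry \<open>x\<close> can be removed from the source at the cost
  of replacing the target by a composite of powers of \<open>\<Psi>\<^sup>+\<close> with \<open>F (j + 1)\<close> and \<open>E (- m + x - 1)\<close>. Because
  \<open>x < m\<close>, the latter two commute, and the target has the original form again, one weight closer to
  \<open>(N, 0)\<close> and with \<open>m\<close> replaced by \<open>m + 1\<close>. When \<open>\<nu>\<close> is exhausted, the target passes through the weight
  \<open>(N + 1, -1)\<close> and vanishes.

  The power of \<open>\<Psi>\<^sup>+\<close> in front makes the statement reproduce itself in the induction. The upper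
  bounds involve only the sum \<open>a + c\<close>; its growth by one at each step is matched by the decrease of
  the length.
\<close>

lemma E_minus_orthogonal:
  assumes "0 \<le> a" "0 \<le> c" "a + c \<le> int N - int (length \<nu>)" "\<forall>x\<in>set \<nu>. 0 \<le> x \<and> x < a + c"
    and "arr (\<W> 0) (\<W> (int (length \<nu>) - 1)) y"
  shows "orth (\<W> 0) (\<W> (int (length \<nu>))) (E_minus K N \<nu>)
    (P (- a) (int (length \<nu>)) \<diamondop> (E (- c) (int (length \<nu>) - 1) \<diamondop> y))"
  using assms
proof (induction \<nu> arbitrary: a c y)
  case Nil
  have y: "arr (\<W> 0) (\<W> (-1)) y" using Nil by simp
  have E: "arr (\<W> (-1)) (\<W> 0) (E (- c) (-1))" using arr_E[of "-1" "- c"] Nil by simp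
  \<comment> \<open>\<open>y\<close> ends at the weight \<open>(N + 1, -1)\<close>, which is outside the range\<close>
  have "zero_ob (HomCat K (\<W> 0) (\<W> (-1))) y"
    using zero_cmp_left[OF outside_one_zero y arr_one[OF W_Ob]] one_left[OF y] by simp
  from zero_cmp_right[OF zero_cmp_right[OF this y E] arr_cmp[OF y E] arr_P]
  show ?case using orth_zero arr_one[OF W_Ob[of 0]] by simp
next
  case (Cons x \<nu>)
  define j where "j = int (length \<nu>)"
  define m where "m = a + c"
  have len: "int (length (x # \<nu>)) = j + 1" by (simp add: j_def)
  have b: "0 \<le> a" "0 \<le> c" "m \<le> int N - j - 1" "0 \<le> x" "x < m" "0 \<le> j"
    using Cons.prems(1-4) by (auto simp: m_def j_def)
  have y: "arr (\<W> 0) (\<W> j) y" using Cons.prems(5) by (simp add: j_def)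
  define V where "V = E_minus K N \<nu>"
  have V: "arr (\<W> 0) (\<W> j) V"
    unfolding V_def j_def by (rule E_minus_arr) (use Cons.prems in force)
  have Ex: "arr (\<W> j) (\<W> (j + 1)) (E (- x) j)" and Em: "arr (\<W> j) (\<W> (j + 1)) (E (- m) j)"
    and Ec: "arr (\<W> j) (\<W> (j + 1)) (E (- c) j)"
    by (rule arr_E; use b m_def in simp)+
  define z where "z = P (- a) j \<diamondop> y"
  have z: "arr (\<W> 0) (\<W> j) z" unfolding z_def by (rule arr_cmp[OF y arr_P])
  \<comment> \<open>the index of \<open>E\<close> after the power \<open>x - 1\<close> of \<open>\<Psi>\<^sup>+\<close> from the adjoint has passed it\<close>
  define r where "r = - m + x - 1"
  define z' where "z' = P (x - 1) j \<diamondop> z"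
  have z': "arr (\<W> 0) (\<W> j) z'" unfolding z'_def by (rule arr_cmp[OF z arr_P])
  obtain G where adj: "right_adjoint K (\<W> j) (\<W> (j + 1)) (E (- x) j) G"
    and G: "sim (\<W> 0) (\<W> j) 1 (G \<diamondop> (E (- m) j \<diamondop> z))
      (P (- x) j \<diamondop> ((F (j + 1) (j + 1) \<diamondop> E r j) \<diamondop> z'))"
    using E_adjoint_E[OF _ _ b(4) _ _ _ _ _ z, of "- m"] b unfolding r_def z'_def by auto
  have Er: "arr (\<W> (j - 1)) (\<W> j) (E r (j - 1))" and Fj: "arr (\<W> j) (\<W> (j - 1)) (F (j + 1) j)"
    using arr_E[of "j - 1" r] arr_F[of "j + 1" j] b by (auto simp: r_def)
  have "iso_ob (HomCat K (\<W> j) (\<W> j)) (F (j + 1) (j + 1) \<diamondop> E r j) (E r (j - 1) \<diamondop> F (j + 1) j)"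
    using E_F_commute[OF wt_weight, of j r "j + 1"] b
    by (auto simp: r_def diff_diff_eq diff_diff_eq2 diff_add_eq)
  from sim_left[OF sim_right[OF sim_iso[OF W_Ob W_Ob this] z'] arr_P, of "- x"]
  have "sim (\<W> 0) (\<W> j) 0 (P (- x) j \<diamondop> ((F (j + 1) (j + 1) \<diamondop> E r j) \<diamondop> z'))
      (P (- x) j \<diamondop> (E r (j - 1) \<diamondop> (F (j + 1) j \<diamondop> z')))"
    using assoc[OF z' Fj Er] by simp
  moreover have "orth (\<W> 0) (\<W> j) V (P (- x) j \<diamondop> (E r (j - 1) \<diamondop> (F (j + 1) j \<diamondop> z')))"
  proof -
    have *: "\<forall>u\<in>set \<nu>. 0 \<le> u \<and> u < x + - r" using Cons.prems(4) by (auto simp: m_def r_def)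
    show ?thesis
      using Cons.IH[of x "- r", OF b(4) _ _ * arr_cmp[OF z' Fj, unfolded j_def]] b
      unfolding V_def j_def[symmetric] by (simp add: r_def)
  qed
  ultimately have "orth (\<W> 0) (\<W> j) V (G \<diamondop> (E (- m) j \<diamondop> z))"
    using orth_sim[OF sim_trans0[OF G] V] by blast
  then have "orth (\<W> 0) (\<W> (j + 1)) (E (- x) j \<diamondop> V) (E (- m) j \<diamondop> z)"
    by (rule adjunction_orth[OF adj V arr_cmp[OF z Em]])
  moreover have "sim (\<W> j) (\<W> (j + 1)) a (P (- a) (j + 1) \<diamondop> E (- c) j) (E (- m) j \<diamondop> P (- a) j)"
    using P_E[of j "- c" "- a"] b by (simp add: m_def add.commute)
  from sim_right[OF this y]
  have "sim (\<W> 0) (\<W> (j + 1)) a (P (- a) (j + 1) \<diamondop> (E (- c) j \<diamondop> y)) (E (- m) j \<diamondop> z)"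
    unfolding z_def using assoc[OF y Ec arr_P] assoc[OF y arr_P Em] by simp
  ultimately have "orth (\<W> 0) (\<W> (j + 1)) (E (- x) j \<diamondop> V) (P (- a) (j + 1) \<diamondop> (E (- c) j \<diamondop> y))"
    using orth_sim[OF _ arr_cmp[OF V Ex]] by blast
  then show ?case unfolding len by (simp add: V_def j_def)
qed

text \<open>
  Let \<open>j\<close> be the length of \<open>\<nu>\<close>. The adjunction turns the left-hand side into maps from \<open>E_minus K N \<nu>\<close> into a conjugate of
  \<open>F (j + 1) (j + 1) \<diamondop> E (-1) j\<close>, shifted by one. In the triangle relating this to \<open>\<Psi>\<^sup>+\<close>, the middle term has
  the form treated in \<open>E_minus_orthogonal\<close>, with \<open>a = m\<close> and \<open>c = 1\<close>, so it receives no maps. In the third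
  term the powers \<open>- m\<close>, \<open>1\<close> and \<open>m - 1\<close> of \<open>\<Psi>\<^sup>+\<close> cancel, which leaves \<open>y\<close> without any shift.
\<close>

lemma E_hom_cancel:
  assumes m: "0 \<le> m" "m < int N - int (length \<nu>)" and \<nu>: "\<forall>x\<in>set \<nu>. 0 \<le> x \<and> x \<le> m"
    and y: "arr (\<W> 0) (\<W> (int (length \<nu>))) y"
  shows "linearly_isomorphic
    (Mor (HomCat K (\<W> 0) (\<W> (int (length \<nu>) + 1)))
      (E (- m) (int (length \<nu>)) \<diamondop> E_minus K N \<nu>) (E (- m) (int (length \<nu>)) \<diamondop> y))
    (Mor (HomCat K (\<W> 0) (\<W> (int (length \<nu>)))) (E_minus K N \<nu>) y)"
proof -
  define j where "j = int (length \<nu>)"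
  define V where "V = E_minus K N \<nu>"
  have j: "0 \<le> j" "j < int N" "j \<le> int N" "m < int N - j" using m by (auto simp: j_def)
  have V: "arr (\<W> 0) (\<W> j) V"
    unfolding V_def j_def by (rule E_minus_arr) (use m \<nu> in force)
  have y: "arr (\<W> 0) (\<W> j) y" using y by (simp add: j_def)
  have Em: "arr (\<W> j) (\<W> (j + 1)) (E (- m) j)"
    by (rule arr_E) (use m j in auto)
  interpret H: triangulated_category "HomCat K (\<W> 0) (\<W> j)" by (rule hom_triangulated[OF V])
  let ?H = "Mor (HomCat K (\<W> 0) (\<W> j)) V"
  let ?FE = "F (j + 1) (j + 1) \<diamondop> E (-1) j" and ?EF = "E (-1) (j - 1) \<diamondop> F (j + 1) j"
  define z where "z = P (m - 1) j \<diamondop> y"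
  have z: "arr (\<W> 0) (\<W> j) z" unfolding z_def by (rule arr_cmp[OF y arr_P])
  obtain G where adj: "right_adjoint K (\<W> j) (\<W> (j + 1)) (E (- m) j) G"
    and G: "sim (\<W> 0) (\<W> j) 1 (G \<diamondop> (E (- m) j \<diamondop> y)) (P (- m) j \<diamondop> (?FE \<diamondop> z))"
    using E_adjoint_E[OF _ _ m(1) _ _ _ _ _ y, of "- m"] m j unfolding z_def by auto
  have "linearly_isomorphic
      (Mor (HomCat K (\<W> 0) (\<W> (j + 1))) (E (- m) j \<diamondop> V) (E (- m) j \<diamondop> y)) (?H (G \<diamondop> (E (- m) j \<diamondop> y)))"
    by (rule adjunction_hom_iso[OF adj V arr_cmp[OF y Em]])
  also have "linearly_isomorphic \<dots> (?H (shift (HomCat K (\<W> 0) (\<W> j)) (P (- m) j \<diamondop> (?FE \<diamondop> z)) 1))"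
    by (rule hom_sim[OF G V])
  finally (linearly_isomorphic_trans) have 1: "linearly_isomorphic
      (Mor (HomCat K (\<W> 0) (\<W> (j + 1))) (E (- m) j \<diamondop> V) (E (- m) j \<diamondop> y))
      (?H (shift (HomCat K (\<W> 0) (\<W> j)) (P (- m) j \<diamondop> (?FE \<diamondop> z)) 1))" .
  have "\<exists>u v w. dtri (HomCat K (\<W> j) (\<W> j)) ?FE ?EF (P 1 j) u v w"
    using triangle_PsiP[OF wt_weight, of j "-1" "j + 1"] j
    by (simp add: P_1 diff_diff_eq diff_diff_eq2 diff_add_eq)
  from dtri_cmp_left[OF dtri_cmp_right[OF this z W_Ob] arr_P W_Ob]
  have tri: "\<exists>u v w. dtri (HomCat K (\<W> 0) (\<W> j)) (P (- m) j \<diamondop> (?FE \<diamondop> z)) (P (- m) j \<diamondop> (?EF \<diamondop> z))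
      (P (- m) j \<diamondop> (P 1 j \<diamondop> z)) u v w" .
  have Fj: "arr (\<W> j) (\<W> (j - 1)) (F (j + 1) j)" and E1: "arr (\<W> (j - 1)) (\<W> j) (E (-1) (j - 1))"
    using arr_F[of "j + 1" j] arr_E[of "j - 1" "-1"] j by auto
  have "orth (\<W> 0) (\<W> j) V (P (- m) j \<diamondop> (?EF \<diamondop> z))"
  proof -
    have "\<forall>x\<in>set \<nu>. 0 \<le> x \<and> x < m + 1" using \<nu> by auto
    from E_minus_orthogonal[OF m(1) _ _ this arr_cmp[OF z Fj, unfolded j_def]]
    show ?thesis using m assoc[OF z Fj E1] by (simp add: V_def j_def)
  qed
  from hom_connecting_orth[OF tri V this]
  have 2: "linearly_isomorphic (?H (P (- m) j \<diamondop> (P 1 j \<diamondop> z)))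
      (?H (shift (HomCat K (\<W> 0) (\<W> j)) (P (- m) j \<diamondop> (?FE \<diamondop> z)) 1))" .
  have "sim (\<W> 0) (\<W> j) 0 (P (- m) j \<diamondop> (P 1 j \<diamondop> z)) y"
  proof -
    have "sim (\<W> 0) (\<W> j) 0 (P 1 j \<diamondop> z) (P m j \<diamondop> y)"
      unfolding z_def
      using sim_right[OF P_add[OF j(1,3), of 1 "m - 1" m] y] assoc[OF y arr_P arr_P] by simp
    from sim_trans[OF sim_left[OF this arr_P] P_cancel[OF j(1,3) y]] show ?thesis by simp
  qed
  from hom_sim[OF this V] have 3: "linearly_isomorphic (?H (P (- m) j \<diamondop> (P 1 j \<diamondop> z))) (?H y)" by (simp only: H.shift_0)
  have "arr (\<W> 0) (\<W> j) (P (- m) j \<diamondop> (P 1 j \<diamondop> z))"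
    by (rule arr_cmp[OF arr_cmp[OF z arr_P] arr_P])
  then have "linearly_isomorphic (?H (shift (HomCat K (\<W> 0) (\<W> j)) (P (- m) j \<diamondop> (?FE \<diamondop> z)) 1))
      (?H (P (- m) j \<diamondop> (P 1 j \<diamondop> z)))"
    using H.lin_iso_sym[OF _ _ 2] V by (simp add: arr_def)
  from linearly_isomorphic_trans[OF linearly_isomorphic_trans[OF 1 this] 3]
  show ?thesis by (simp add: j_def V_def)
qed

text \<open>
  Weak decrease of \<open>\<mu>\<close> is the bound on the later entries under which the first one can be cancelled.
\<close>

lemma E_minus_endo:
  assumes "sorted_wrt (\<ge>) \<mu>" "\<forall>x\<in>set \<mu>. 0 \<le> x \<and> x \<le> int N - int (length \<mu>)"
  shows "linearly_isomorphic
    (Mor (HomCat K (\<W> 0) (\<W> (int (length \<mu>)))) (E_minus K N \<mu>) (E_minus K N \<mu>))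
    (Mor (HomCat K (\<W> 0) (\<W> 0)) (one1 K (\<W> 0)) (one1 K (\<W> 0)))"
  using assms
proof (induction \<mu>)
  case Nil
  then show ?case by (simp add: linearly_isomorphic_refl)
next
  case (Cons x \<mu>)
  have b: "\<forall>u\<in>set \<mu>. 0 \<le> u \<and> u \<le> int N - int (length \<mu>)" using Cons.prems(2) by force
  have "linearly_isomorphic
    (Mor (HomCat K (\<W> 0) (\<W> (int (length \<mu>) + 1)))
      (E (- x) (int (length \<mu>)) \<diamondop> E_minus K N \<mu>) (E (- x) (int (length \<mu>)) \<diamondop> E_minus K N \<mu>))
    (Mor (HomCat K (\<W> 0) (\<W> (int (length \<mu>)))) (E_minus K N \<mu>) (E_minus K N \<mu>))"
    by (rule E_hom_cancel[OF _ _ _ E_minus_arr[OF b]]) (use Cons.prems in auto)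
  from linearly_isomorphic_trans[OF this Cons.IH] b Cons.prems(1)
  show ?case by (simp add: add.commute)
qed

text \<open>
  Equal first entries are cancelled. At the first difference \<open>x < y\<close>, all remaining entries of \<open>\<mu>\<close> are at
  most \<open>x\<close>, hence below \<open>y\<close>, and \<open>E_minus_orthogonal\<close> applies with \<open>a = 0\<close> and \<open>c = y\<close>.
\<close>

lemma E_minus_hom_zero:
  assumes "sorted_wrt (\<ge>) \<mu>" "\<forall>x\<in>set \<mu>. 0 \<le> x \<and> x \<le> int N - int (length \<mu>)"
    and "\<forall>x\<in>set \<mu>'. 0 \<le> x \<and> x \<le> int N - int (length \<mu>)"
    and "length \<mu>' = length \<mu>" "lex_less \<mu> \<mu>'"
  shows "mor (HomCat K (\<W> 0) (\<W> (int (length \<mu>)))) (E_minus K N \<mu>) (E_minus K N \<mu>')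
    = {\<zero>\<^bsub>Mor (HomCat K (\<W> 0) (\<W> (int (length \<mu>)))) (E_minus K N \<mu>) (E_minus K N \<mu>')\<^esub>}"
  using assms
proof (induction \<mu> arbitrary: \<mu>')
  case Nil
  then show ?case by (simp add: lex_less_def)
next
  case (Cons x \<mu>)
  then obtain y \<mu>'' where \<mu>': "\<mu>' = y # \<mu>''" and len: "length \<mu>'' = length \<mu>"
    by (cases \<mu>') auto
  define j where "j = int (length \<mu>)"
  have b: "\<forall>u\<in>set \<mu>. 0 \<le> u \<and> u \<le> int N - int (length \<mu>)"
    "\<forall>u\<in>set \<mu>''. 0 \<le> u \<and> u \<le> int N - int (length \<mu>'')"
    using Cons.prems(2,3) \<mu>' len by force+
  have Y: "arr (\<W> 0) (\<W> j) (E_minus K N \<mu>'')"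
    using E_minus_arr[OF b(2)] len by (simp add: j_def)
  have V: "arr (\<W> 0) (\<W> j) (E_minus K N \<mu>)" using E_minus_arr[OF b(1)] by (simp add: j_def)
  have EX: "arr (\<W> 0) (\<W> (j + 1)) (E_minus K N (x # \<mu>))"
    using E_minus_arr[OF Cons.prems(2)] by (simp add: j_def add.commute)
  have EY: "arr (\<W> 0) (\<W> (j + 1)) (E_minus K N \<mu>')"
    using E_minus_arr[of \<mu>'] Cons.prems(3,4) by (simp add: j_def add.commute)
  interpret H: triangulated_category "HomCat K (\<W> 0) (\<W> (j + 1))" by (rule hom_triangulated[OF EX])
  interpret H': triangulated_category "HomCat K (\<W> 0) (\<W> j)" by (rule hom_triangulated[OF V])
  consider "x < y" | "x = y" "lex_less \<mu> \<mu>''"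
    using Cons.prems(5) \<mu>' lex_less_Cons by auto
  then have "mor (HomCat K (\<W> 0) (\<W> (j + 1))) (E_minus K N (x # \<mu>)) (E_minus K N \<mu>')
    = {\<zero>\<^bsub>Mor (HomCat K (\<W> 0) (\<W> (j + 1))) (E_minus K N (x # \<mu>)) (E_minus K N \<mu>')\<^esub>}"
  proof cases
    case 1
    have "orth (\<W> 0) (\<W> (j + 1)) (E_minus K N (x # \<mu>)) (P (- 0) (j + 1) \<diamondop> (E (- y) j \<diamondop> E_minus K N \<mu>''))"
      using E_minus_orthogonal[of 0 y "x # \<mu>" "E_minus K N \<mu>''"] Cons.prems 1 \<mu>' Y
      by (force simp: j_def add.commute)
    moreover have "P (- 0) (j + 1) \<diamondop> (E (- y) j \<diamondop> E_minus K N \<mu>'') = E_minus K N \<mu>'"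
      using one_left[OF EY] by (simp add: P_0 \<mu>' j_def len)
    ultimately show ?thesis
      unfolding orth_def H.orthogonal_def using H.shift_0 by metis
  next
    case 2
    have "mor (HomCat K (\<W> 0) (\<W> j)) (E_minus K N \<mu>) (E_minus K N \<mu>'')
      = {\<zero>\<^bsub>Mor (HomCat K (\<W> 0) (\<W> j)) (E_minus K N \<mu>) (E_minus K N \<mu>'')\<^esub>}"
      unfolding j_def by (rule Cons.IH) (use Cons.prems(1) b len 2 in auto)
    moreover have "linearly_isomorphic
      (Mor (HomCat K (\<W> 0) (\<W> (j + 1))) (E (- x) j \<diamondop> E_minus K N \<mu>) (E (- x) j \<diamondop> E_minus K N \<mu>''))
      (Mor (HomCat K (\<W> 0) (\<W> j)) (E_minus K N \<mu>) (E_minus K N \<mu>''))"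
      unfolding j_def by (rule E_hom_cancel) (use Cons.prems(1,2) Y in \<open>auto simp: j_def\<close>)
    then have "linearly_isomorphic
      (Mor (HomCat K (\<W> 0) (\<W> (j + 1))) (E_minus K N (x # \<mu>)) (E_minus K N \<mu>'))
      (Mor (HomCat K (\<W> 0) (\<W> j)) (E_minus K N \<mu>) (E_minus K N \<mu>''))"
      using 2 by (simp add: \<mu>' j_def len)
    ultimately show ?thesis
      using linearly_isomorphic_zero[OF _ H.hom_abelian H'.hom_abelian] V Y EX EY
      by (simp add: arr_def)
  qed
  then show ?case by (simp add: j_def add.commute)
qed

end

theorem theorem4p6:
  fixes N k :: nat and K :: "('x, 'y, 'f, 'm) sl2_data"
  assumes "N \<ge> 2" and "k \<le> N" and "partial_sl2_action N K"
  shows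
    "(\<forall>\<mu> \<in> partitions_in k (N - k).
        linearly_isomorphic
          (Mor (Hm K (int N, 0) (int k, int (N - k))) (E_minus K N \<mu>) (E_minus K N \<mu>))
          (Mor (Hm K (int N, 0) (int N, 0)) (one_wt K (int N, 0)) (one_wt K (int N, 0)))) \<and>
     (\<forall>\<mu> \<in> partitions_in k (N - k). \<forall>\<mu>' \<in> partitions_in k (N - k). lex_less \<mu> \<mu>' \<longrightarrow>
        carrier (Mor (Hm K (int N, 0) (int k, int (N - k))) (E_minus K N \<mu>) (E_minus K N \<mu>'))
          = {\<zero>\<^bsub>Mor (Hm K (int N, 0) (int k, int (N - k))) (E_minus K N \<mu>) (E_minus K N \<mu>')\<^esub>})"
proof -
  interpret partial_sl2_action N K by fact
  have k: "int N - int (N - k) = int k" using assms(2) by simp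
  have \<mu>: "length \<mu> = N - k" "sorted_wrt (\<ge>) \<mu>" "\<forall>x\<in>set \<mu>. 0 \<le> x \<and> x \<le> int N - int (length \<mu>)"
    if "\<mu> \<in> partitions_in k (N - k)" for \<mu>
    using that k by (auto simp: partitions_in_def)
  show ?thesis
  proof (intro conjI ballI impI)
    fix \<mu> assume "\<mu> \<in> partitions_in k (N - k)"
    note m = \<mu>[OF this]
    show "linearly_isomorphic
          (Mor (Hm K (int N, 0) (int k, int (N - k))) (E_minus K N \<mu>) (E_minus K N \<mu>))
          (Mor (Hm K (int N, 0) (int N, 0)) (one_wt K (int N, 0)) (one_wt K (int N, 0)))"
      using E_minus_endo[OF m(2,3)] by (simp only: m(1) k diff_zero)
    fix \<mu>' assume "\<mu>' \<in> partitions_in k (N - k)" "lex_less \<mu> \<mu>'"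
    note m' = \<mu>[OF this(1)] this(2)
    show "carrier (Mor (Hm K (int N, 0) (int k, int (N - k))) (E_minus K N \<mu>) (E_minus K N \<mu>'))
          = {\<zero>\<^bsub>Mor (Hm K (int N, 0) (int k, int (N - k))) (E_minus K N \<mu>) (E_minus K N \<mu>')\<^esub>}"
      using E_minus_hom_zero[OF m(2,3) _ _ m'(4)] m' m by (simp only: k diff_zero)
  qed
qed

end
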